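(* Let $T$ be a finite-dimensional$^{\circ}$ theory, and work in a model of $T$. Let $G$ be a definable connected nilpotent group and let $A$ be a definable connected abelian group on which $G$ acts definably by group automorphisms, so that $(G,A)$ is a definable $G$-module. Suppose that $A^G=0$. Then $H^1(G,A)=0$.
   Context: A first-order theory $T$ is finite-dimensional if there is a function $\dim$ from the collection of all interpretable sets in models of $T$ to $\mathbb{N}$ such that, for every formula $\phi(x,y)$ and interpretable sets $X,Y$: (Invariance) if $a\equiv a'$ then $\dim(\phi(x,a))=\dim(\phi(x,a'))$; (Finiteness) $\dim(X)=0$ iff $X$ is finite; (Union) $\dim(X\cup Y)=\max\{\dim X,\dim Y\}$; (Fibration) if $f:X\to Y$ is interpretable and $\dim(f^{-1}(y))\ge d$ for all $y\in Y$, then $\dim(X)\ge\dim(Y)+d$. It is finite-dimensional$^{\circ}$ if moreover every definable group has a smallest definable subgroup of finite index (its connected component). A definable group is connected if it has no proper definable subgroup of finite index. For a $G$-module $A$ (written additively, action $g\cdot a$): $A^G=\{a\in A: g\cdot a=a \text{ for all } g\in G\}$; $H^1(G,A)=\operatorname{Der}(G,A)/\operatorname{IDer}(G,A)$ where $\operatorname{Der}(G,A)$ is the group of all maps $f:G\to A$ with $f(xy)=x\cdot f(y)+f(x)$ for all $x,y\in G$, and $\operatorname{IDer}(G,A)$ is the subgroup of maps of the form $f(x)=x\cdot a-a$ for some fixed $a\in A$. *)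

theory Defs
  imports "HOL-Algebra.Bij" "HOL-Algebra.Generated_Groups" "HOL-Algebra.Elementary_Groups"
begin

section \<open>First-order logic\<close>

text \<open>A language is a set of function symbols and a set of relation symbols, each with its
  arity; constants are function symbols of arity \<open>0\<close>.\<close>

record ('f, 'r) lang =
  fun_syms :: "('f \<times> nat) set"
  rel_syms :: "('r \<times> nat) set"

text \<open>Variables are de Bruijn indices: under \<open>Exi\<close> the bound variable is \<open>0\<close>, and a formula is
  evaluated in a list of values, \<open>Var i\<close> denoting the \<open>i\<close>-th entry.\<close>

datatype 'f tm = Var nat | App 'f "'f tm list"

datatype ('f, 'r) fm =
    Eql "'f tm" "'f tm"
  | Rel 'r "'f tm list"
  | Neg "('f, 'r) fm"
  | Conj "('f, 'r) fm" "('f, 'r) fm"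
  | Exi "('f, 'r) fm"

text \<open>\<open>wf_fm L k \<phi>\<close>: \<open>\<phi>\<close> is a formula of \<open>L\<close> whose free variables are among \<open>0, \<dots>, k - 1\<close>.\<close>

fun wf_tm :: "('f, 'r) lang \<Rightarrow> nat \<Rightarrow> 'f tm \<Rightarrow> bool" where
  "wf_tm L k (Var i) \<longleftrightarrow> i < k"
| "wf_tm L k (App f ts) \<longleftrightarrow> (f, length ts) \<in> fun_syms L \<and> (\<forall>t\<in>set ts. wf_tm L k t)"

fun wf_fm :: "('f, 'r) lang \<Rightarrow> nat \<Rightarrow> ('f, 'r) fm \<Rightarrow> bool" where
  "wf_fm L k (Eql s t) \<longleftrightarrow> wf_tm L k s \<and> wf_tm L k t"
| "wf_fm L k (Rel r ts) \<longleftrightarrow> (r, length ts) \<in> rel_syms L \<and> (\<forall>t\<in>set ts. wf_tm L k t)"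
| "wf_fm L k (Neg \<phi>) \<longleftrightarrow> wf_fm L k \<phi>"
| "wf_fm L k (Conj \<phi> \<psi>) \<longleftrightarrow> wf_fm L k \<phi> \<and> wf_fm L k \<psi>"
| "wf_fm L k (Exi \<phi>) \<longleftrightarrow> wf_fm L (Suc k) \<phi>"

record ('u, 'f, 'r) fo_struct = "'u partial_object" +
  fun_int :: "'f \<Rightarrow> 'u list \<Rightarrow> 'u"
  rel_int :: "'r \<Rightarrow> 'u list \<Rightarrow> bool"

definition is_struct :: "('f, 'r) lang \<Rightarrow> ('u, 'f, 'r) fo_struct \<Rightarrow> bool" where
  "is_struct L M \<longleftrightarrow> carrier M \<noteq> {} \<and>
     (\<forall>(f, k) \<in> fun_syms L. \<forall>xs. length xs = k \<and> set xs \<subseteq> carrier M \<longrightarrow> fun_int M f xs \<in> carrier M)"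

fun eval :: "('u, 'f, 'r) fo_struct \<Rightarrow> 'u list \<Rightarrow> 'f tm \<Rightarrow> 'u" where
  "eval M e (Var i) = e ! i"
| "eval M e (App f ts) = fun_int M f (map (eval M e) ts)"

fun sat :: "('u, 'f, 'r) fo_struct \<Rightarrow> 'u list \<Rightarrow> ('f, 'r) fm \<Rightarrow> bool" where
  "sat M e (Eql s t) \<longleftrightarrow> eval M e s = eval M e t"
| "sat M e (Rel r ts) \<longleftrightarrow> rel_int M r (map (eval M e) ts)"
| "sat M e (Neg \<phi>) \<longleftrightarrow> \<not> sat M e \<phi>"
| "sat M e (Conj \<phi> \<psi>) \<longleftrightarrow> sat M e \<phi> \<and> sat M e \<psi>"
| "sat M e (Exi \<phi>) \<longleftrightarrow> (\<exists>x\<in>carrier M. sat M (x # e) \<phi>)"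

definition is_theory :: "('f, 'r) lang \<Rightarrow> ('f, 'r) fm set \<Rightarrow> bool" where
  "is_theory L T \<longleftrightarrow> (\<forall>\<sigma>\<in>T. wf_fm L 0 \<sigma>)"

definition model :: "('f, 'r) lang \<Rightarrow> ('f, 'r) fm set \<Rightarrow> ('u, 'f, 'r) fo_struct \<Rightarrow> bool" where
  "model L T M \<longleftrightarrow> is_struct L M \<and> (\<forall>\<sigma>\<in>T. sat M [] \<sigma>)"

text \<open>\<open>same_type L M as M' as'\<close> is \<open>a \<equiv> a'\<close> for finite tuples from possibly different models.\<close>

definition same_type ::
    "('f, 'r) lang \<Rightarrow> ('u, 'f, 'r) fo_struct \<Rightarrow> 'u list \<Rightarrow> ('u, 'f, 'r) fo_struct \<Rightarrow> 'u list \<Rightarrow> bool" where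
  "same_type L M as M' as' \<longleftrightarrow>
     length as = length as' \<and> (\<forall>\<psi>. wf_fm L (length as) \<psi> \<longrightarrow> sat M as \<psi> = sat M' as' \<psi>)"


section \<open>Definable and interpretable sets\<close>

text \<open>In \<open>\<phi>(x, a)\<close> the variables \<open>0, \<dots>, n - 1\<close> of \<open>\<phi>\<close> stand for \<open>x\<close>, the following ones for the
  parameters.\<close>

definition dset :: "('u, 'f, 'r) fo_struct \<Rightarrow> nat \<Rightarrow> ('f, 'r) fm \<Rightarrow> 'u list \<Rightarrow> 'u list set" where
  "dset M n \<phi> as = {xs. length xs = n \<and> set xs \<subseteq> carrier M \<and> sat M (xs @ as) \<phi>}"

definition drel :: "('u, 'f, 'r) fo_struct \<Rightarrow> nat \<Rightarrow> ('f, 'r) fm \<Rightarrow> 'u list \<Rightarrow> ('u list \<times> 'u list) set" where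
  "drel M n \<epsilon> as = {(xs, ys). length xs = n \<and> length ys = n \<and> xs @ ys \<in> dset M (2 * n) \<epsilon> as}"

definition definable :: "('f, 'r) lang \<Rightarrow> ('u, 'f, 'r) fo_struct \<Rightarrow> 'u list set \<Rightarrow> bool" where
  "definable L M X \<longleftrightarrow>
     (\<exists>n \<phi> as. set as \<subseteq> carrier M \<and> wf_fm L (n + length as) \<phi> \<and> X = dset M n \<phi> as)"

text \<open>The interpretable set \<open>D / E\<close> given by formulas for \<open>D\<close> and for the equivalence relation \<open>E\<close>
  on \<open>D\<close> is the set of \<open>E\<close>-classes. A definable set \<open>D\<close> occurs as the set of singletons
  \<open>D / (=)\<close>.\<close>

definition is_interp ::
    "('f, 'r) lang \<Rightarrow> ('u, 'f, 'r) fo_struct \<Rightarrow> nat \<Rightarrow> ('f, 'r) fm \<Rightarrow> ('f, 'r) fm \<Rightarrow> 'u list \<Rightarrow> bool" where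
  "is_interp L M n \<phi> \<epsilon> as \<longleftrightarrow>
     set as \<subseteq> carrier M \<and> wf_fm L (n + length as) \<phi> \<and> wf_fm L (2 * n + length as) \<epsilon> \<and>
     equiv (dset M n \<phi> as) (drel M n \<epsilon> as)"

definition iset ::
    "('u, 'f, 'r) fo_struct \<Rightarrow> nat \<Rightarrow> ('f, 'r) fm \<Rightarrow> ('f, 'r) fm \<Rightarrow> 'u list \<Rightarrow> 'u list set set" where
  "iset M n \<phi> \<epsilon> as = dset M n \<phi> as // drel M n \<epsilon> as"

definition interpretable :: "('f, 'r) lang \<Rightarrow> ('u, 'f, 'r) fo_struct \<Rightarrow> 'u list set set \<Rightarrow> bool" where
  "interpretable L M X \<longleftrightarrow> (\<exists>n \<phi> \<epsilon> as. is_interp L M n \<phi> \<epsilon> as \<and> X = iset M n \<phi> \<epsilon> as)"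

text \<open>A map between interpretable sets is interpretable if its graph, lifted to representatives,
  is definable. All elements of classes of one interpretable set have the same length, so
  concatenation loses no information.\<close>

definition interpretable_map ::
    "('f, 'r) lang \<Rightarrow> ('u, 'f, 'r) fo_struct \<Rightarrow> 'u list set set \<Rightarrow> 'u list set set \<Rightarrow>
     ('u list set \<Rightarrow> 'u list set) \<Rightarrow> bool" where
  "interpretable_map L M X Y f \<longleftrightarrow>
     f \<in> X \<rightarrow> Y \<and> definable L M {xs @ ys | xs ys. \<exists>c\<in>X. xs \<in> c \<and> ys \<in> f c}"


section \<open>Definable groups\<close>

definition definable_group :: "('f, 'r) lang \<Rightarrow> ('u, 'f, 'r) fo_struct \<Rightarrow> 'u list monoid \<Rightarrow> bool" where
  "definable_group L M G \<longleftrightarrow> group G \<and> definable L M (carrier G) \<and>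
     definable L M {x @ y @ (x \<otimes>\<^bsub>G\<^esub> y) | x y. x \<in> carrier G \<and> y \<in> carrier G}"

definition definable_finite_index ::
    "('f, 'r) lang \<Rightarrow> ('u, 'f, 'r) fo_struct \<Rightarrow> 'u list monoid \<Rightarrow> 'u list set \<Rightarrow> bool" where
  "definable_finite_index L M G H \<longleftrightarrow>
     subgroup H G \<and> definable L M H \<and> finite (rcosets\<^bsub>G\<^esub> H)"

definition connected_group :: "('f, 'r) lang \<Rightarrow> ('u, 'f, 'r) fo_struct \<Rightarrow> 'u list monoid \<Rightarrow> bool" where
  "connected_group L M G \<longleftrightarrow> (\<forall>H. definable_finite_index L M G H \<longrightarrow> H = carrier G)"

definition has_connected_component ::
    "('f, 'r) lang \<Rightarrow> ('u, 'f, 'r) fo_struct \<Rightarrow> 'u list monoid \<Rightarrow> bool" where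
  "has_connected_component L M G \<longleftrightarrow>
     (\<exists>H. definable_finite_index L M G H \<and> (\<forall>K. definable_finite_index L M G K \<longrightarrow> H \<subseteq> K))"


section \<open>Finite-dimensional theories\<close>

text \<open>As HOL cannot quantify over all types inside a definition, only models with carrier inside
  the type \<open>'u\<close> are considered.

  Dimension is \<open>nat\<close>-valued and the empty set, being finite, has dimension \<open>0\<close>. The fibration
  axiom is meant for nonempty fibres: applied to an empty fibre (with \<open>d = 0\<close>) it would bound the
  dimension of every interpretable set by that of a point, and applied to the map from the empty
  set to itself it would be contradictory. Hence \<open>f\<close> is required to be onto and \<open>Y\<close> nonempty.\<close>

definition is_dimension ::
    "('f, 'r) lang \<Rightarrow> ('f, 'r) fm set \<Rightarrow> (('u, 'f, 'r) fo_struct \<Rightarrow> 'u list set set \<Rightarrow> nat) \<Rightarrow> bool" where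
  "is_dimension L T dim \<longleftrightarrow>
     \<comment> \<open>Invariance\<close>
     (\<forall>M M' n \<phi> \<epsilon> as as'. model L T M \<and> model L T M' \<and> same_type L M as M' as' \<and>
        is_interp L M n \<phi> \<epsilon> as \<and> is_interp L M' n \<phi> \<epsilon> as' \<longrightarrow>
        dim M (iset M n \<phi> \<epsilon> as) = dim M' (iset M' n \<phi> \<epsilon> as')) \<and>
     \<comment> \<open>Finiteness\<close>
     (\<forall>M X. model L T M \<and> interpretable L M X \<longrightarrow> (dim M X = 0 \<longleftrightarrow> finite X)) \<and>
     \<comment> \<open>Union; \<open>X \<union> Y\<close> is interpretable iff \<open>X\<close> and \<open>Y\<close> are subsets of a common sort\<close>
     (\<forall>M X Y. model L T M \<and> interpretable L M X \<and> interpretable L M Y \<and> interpretable L M (X \<union> Y) \<longrightarrow>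
        dim M (X \<union> Y) = max (dim M X) (dim M Y)) \<and>
     \<comment> \<open>Fibration\<close>
     (\<forall>M X Y f d. model L T M \<and> interpretable L M X \<and> interpretable L M Y \<and>
        interpretable_map L M X Y f \<and> f ` X = Y \<and> Y \<noteq> {} \<and>
        (\<forall>y\<in>Y. dim M {x \<in> X. f x = y} \<ge> d) \<longrightarrow>
        dim M X \<ge> dim M Y + d)"

definition finite_dimensional :: "'u itself \<Rightarrow> ('f, 'r) lang \<Rightarrow> ('f, 'r) fm set \<Rightarrow> bool" where
  "finite_dimensional _ L T \<longleftrightarrow>
     (\<exists>dim :: ('u, 'f, 'r) fo_struct \<Rightarrow> 'u list set set \<Rightarrow> nat. is_dimension L T dim)"

definition finite_dimensional_conn :: "'u itself \<Rightarrow> ('f, 'r) lang \<Rightarrow> ('f, 'r) fm set \<Rightarrow> bool" where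
  "finite_dimensional_conn U L T \<longleftrightarrow> finite_dimensional U L T \<and>
     (\<forall>(M :: ('u, 'f, 'r) fo_struct) G. model L T M \<and> definable_group L M G \<longrightarrow>
        has_connected_component L M G)"


section \<open>Nilpotent groups\<close>

fun lower_central :: "('a, 'b) monoid_scheme \<Rightarrow> nat \<Rightarrow> 'a set" where
  "lower_central G 0 = carrier G"
| "lower_central G (Suc k) = generate G
     {h \<otimes>\<^bsub>G\<^esub> g \<otimes>\<^bsub>G\<^esub> inv\<^bsub>G\<^esub> h \<otimes>\<^bsub>G\<^esub> inv\<^bsub>G\<^esub> g | h g. h \<in> lower_central G k \<and> g \<in> carrier G}"

definition nilpotent_group :: "('a, 'b) monoid_scheme \<Rightarrow> bool" where
  "nilpotent_group G \<longleftrightarrow> group G \<and> (\<exists>n. lower_central G n = {\<one>\<^bsub>G\<^esub>})"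


section \<open>Modules and first cohomology\<close>

text \<open>The abelian group \<open>A\<close> is a multiplicative \<open>comm_group\<close>: \<open>\<otimes>\<close>, \<open>\<one>\<close> and \<open>inv\<close> are the addition,
  zero and negation of the module.\<close>

definition is_module :: "('g, 'b) monoid_scheme \<Rightarrow> 'a monoid \<Rightarrow> ('g \<Rightarrow> 'a \<Rightarrow> 'a) \<Rightarrow> bool" where
  "is_module G A act \<longleftrightarrow> group G \<and> comm_group A \<and> act \<in> hom G (AutoGroup A)"

definition definable_module ::
    "('f, 'r) lang \<Rightarrow> ('u, 'f, 'r) fo_struct \<Rightarrow> 'u list monoid \<Rightarrow> 'u list monoid \<Rightarrow>
     ('u list \<Rightarrow> 'u list \<Rightarrow> 'u list) \<Rightarrow> bool" where
  "definable_module L M G A act \<longleftrightarrow>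
     definable_group L M G \<and> definable_group L M A \<and> is_module G A act \<and>
     definable L M {g @ a @ act g a | g a. g \<in> carrier G \<and> a \<in> carrier A}"

definition fixed_points :: "('g, 'b) monoid_scheme \<Rightarrow> 'a monoid \<Rightarrow> ('g \<Rightarrow> 'a \<Rightarrow> 'a) \<Rightarrow> 'a set" where
  "fixed_points G A act = {a \<in> carrier A. \<forall>g\<in>carrier G. act g a = a}"

definition Der :: "('g, 'b) monoid_scheme \<Rightarrow> 'a monoid \<Rightarrow> ('g \<Rightarrow> 'a \<Rightarrow> 'a) \<Rightarrow> ('g \<Rightarrow> 'a) monoid" where
  "Der G A act =
     \<lparr>carrier = {f \<in> carrier G \<rightarrow>\<^sub>E carrier A.
        \<forall>x\<in>carrier G. \<forall>y\<in>carrier G. f (x \<otimes>\<^bsub>G\<^esub> y) = act x (f y) \<otimes>\<^bsub>A\<^esub> f x},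
      mult = (\<lambda>f h. \<lambda>x\<in>carrier G. f x \<otimes>\<^bsub>A\<^esub> h x),
      one = (\<lambda>x\<in>carrier G. \<one>\<^bsub>A\<^esub>)\<rparr>"

definition IDer :: "('g, 'b) monoid_scheme \<Rightarrow> 'a monoid \<Rightarrow> ('g \<Rightarrow> 'a \<Rightarrow> 'a) \<Rightarrow> ('g \<Rightarrow> 'a) set" where
  "IDer G A act = {\<lambda>x\<in>carrier G. act x a \<otimes>\<^bsub>A\<^esub> inv\<^bsub>A\<^esub> a | a. a \<in> carrier A}"

definition H1 :: "('g, 'b) monoid_scheme \<Rightarrow> 'a monoid \<Rightarrow> ('g \<Rightarrow> 'a \<Rightarrow> 'a) \<Rightarrow> ('g \<Rightarrow> 'a) set monoid" where
  "H1 G A act = Der G A act Mod IDer G A act"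

end

theory Submission
  imports Defs
begin

text \<open>Argue by induction on the dimension of a connected definable submodule \<open>B\<close>. Let \<open>C\<close> be a proper
  connected definable submodule of \<open>B\<close> of maximal dimension. As a connected group acts trivially on
  finite sets and \<open>H\<^sup>1(G, C) = 0\<close> by induction, \<open>B/C\<close> has no fixed points and is irreducible. By
  nilpotency some \<open>g\<close> acts nontrivially on \<open>B/C\<close> and commutes with \<open>G\<close> up to elements acting
  trivially; so \<open>b \<mapsto> gb - b\<close> is injective on \<open>B/C\<close> by irreducibility, and onto by dimension and
  connectedness. A derivation normalised to vanish at \<open>g\<close> modulo \<open>C\<close> takes values in \<open>C\<close>, where the
  induction hypothesis applies. Quotients such as \<open>B/C\<close> are interpretable but not definable, so
  they are handled through congruences modulo \<open>C\<close>.\<close>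

section \<open>Definable predicates and functions\<close>

text \<open>So every count is arranged to use lower bounds alone: the strict growth of dimension
  from a proper subgroup to a connected group, and the squeeze by which an injective endomorphism of
  B/C has an image of finite index. Maximality of C gives irreducibility through components. If D is
  a definable submodule with C in D and D properly in B, its connected component contains C, because
  C is connected, and hence equals C by maximality. So D/C is finite, G acts trivially on it, and
  the absence of fixed points in B/C forces D = C. The element g is taken from the last term of the
  lower central series that acts nontrivially on B/C; its commutators lie in the next term and so
  act trivially. The induction descends into A because A^G = 0 passes to submodules. The derivations
  themselves are arbitrary: definability concerns only submodules, stabilisers modulo submodules,
  and maps induced by single elements of G.\<close>

fun ren_tm :: "(nat \<Rightarrow> nat) \<Rightarrow> 'f tm \<Rightarrow> 'f tm" where
  "ren_tm \<sigma> (Var i) = Var (\<sigma> i)"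
| "ren_tm \<sigma> (App f ts) = App f (map (ren_tm \<sigma>) ts)"

text \<open>Under \<open>Exi\<close> the bound variable stays \<open>0\<close> and every free index
  is shifted on both sides, which is what \<open>case_nat 0 (Suc \<circ> \<sigma>)\<close> does; no
  capture can occur.\<close>

fun ren_fm :: "(nat \<Rightarrow> nat) \<Rightarrow> ('f, 'r) fm \<Rightarrow> ('f, 'r) fm" where
  "ren_fm \<sigma> (Eql s t) = Eql (ren_tm \<sigma> s) (ren_tm \<sigma> t)"
| "ren_fm \<sigma> (Rel r ts) = Rel r (map (ren_tm \<sigma>) ts)"
| "ren_fm \<sigma> (Neg \<phi>) = Neg (ren_fm \<sigma> \<phi>)"
| "ren_fm \<sigma> (Conj \<phi> \<psi>) = Conj (ren_fm \<sigma> \<phi>) (ren_fm \<sigma> \<psi>)"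
| "ren_fm \<sigma> (Exi \<phi>) = Exi (ren_fm (case_nat 0 (Suc \<circ> \<sigma>)) \<phi>)"

lemma eval_ren_tm:
  "wf_tm L k t \<Longrightarrow> \<forall>i<k. e' ! \<sigma> i = e ! i \<Longrightarrow> eval M e' (ren_tm \<sigma> t) = eval M e t"
proof (induction t)
  case (App f ts)
  have "map (eval M e') (map (ren_tm \<sigma>) ts) = map (eval M e) ts"
    using App by auto
  then show ?case by (simp only: ren_tm.simps eval.simps)
qed simp

text \<open>Only the entries named by free variables influence the truth value. Nothing forces
  \<open>\<sigma>\<close> to be injective or \<open>e\<close> and \<open>e'\<close> to have equal
  length, so permuting, identifying and skipping entries are all covered.\<close>

lemma sat_ren_fm:
  "wf_fm L k \<phi> \<Longrightarrow> \<forall>i<k. e' ! \<sigma> i = e ! i \<Longrightarrow> sat M e' (ren_fm \<sigma> \<phi>) = sat M e \<phi>"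
proof (induction \<phi> arbitrary: k \<sigma> e e')
  case (Eql s t)
  then show ?case
    using eval_ren_tm[of L k s e' \<sigma> e M] eval_ren_tm[of L k t e' \<sigma> e M] by simp
next
  case (Rel r ts)
  have "map (eval M e') (map (ren_tm \<sigma>) ts) = map (eval M e) ts"
    using Rel.prems eval_ren_tm[of L k _ e' \<sigma> e M] by simp
  then show ?case by (simp only: ren_fm.simps sat.simps)
next
  case (Exi \<phi>)
  have "sat M (x # e') (ren_fm (case_nat 0 (Suc \<circ> \<sigma>)) \<phi>) = sat M (x # e) \<phi>" for x
    using Exi.prems by (intro Exi.IH[of "Suc k"]) (auto simp: nth_Cons split: nat.splits)
  then show ?case by simp
next
  case (Conj \<phi> \<psi>)
  then show ?case using Conj.IH(1)[of k e' \<sigma> e] Conj.IH(2)[of k e' \<sigma> e] by simp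
qed auto

lemma wf_ren_tm: "wf_tm L k t \<Longrightarrow> \<forall>i<k. \<sigma> i < k' \<Longrightarrow> wf_tm L k' (ren_tm \<sigma> t)"
  by (induction t) auto

lemma wf_ren_fm: "wf_fm L k \<phi> \<Longrightarrow> \<forall>i<k. \<sigma> i < k' \<Longrightarrow> wf_fm L k' (ren_fm \<sigma> \<phi>)"
proof (induction \<phi> arbitrary: k k' \<sigma>)
  case (Exi \<phi>)
  have "wf_fm L (Suc k') (ren_fm (case_nat 0 (Suc \<circ> \<sigma>)) \<phi>)"
    using Exi.prems by (intro Exi.IH[of "Suc k"]) (auto split: nat.splits)
  then show ?case by simp
qed (auto intro: wf_ren_tm)

text \<open>The empty conjunction must be true, and the syntax has no constant for truth. The
  formula \<open>Neg (Exi (Neg ...))\<close> serves: it is valid and closed, hence well formed in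
  every context.\<close>

fun eq_block :: "nat \<Rightarrow> nat \<Rightarrow> ('f, 'r) fm" where
  "eq_block m 0 = Neg (Exi (Neg (Eql (Var 0) (Var 0))))"
| "eq_block m (Suc k) = Conj (eq_block m k) (Eql (Var k) (Var (m + k)))"

lemma wf_eq_block: "k \<le> m \<Longrightarrow> 2 * m \<le> n \<Longrightarrow> wf_fm L n (eq_block m k)"
  by (induction k) auto

lemma sat_eq_block: "sat M e (eq_block m k) \<longleftrightarrow> (\<forall>i<k. e ! i = e ! (m + i))"
  by (induction k) (auto simp: less_Suc_eq)

locale fo_structure =
  fixes L :: "('f, 'r) lang" and M :: "('u, 'f, 'r) fo_struct"
begin

definition tuples :: "nat \<Rightarrow> 'u list set" where
  "tuples n = {xs. length xs = n \<and> set xs \<subseteq> carrier M}"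

lemma sat_Exi_funpow: "sat M e ((Exi ^^ m) \<phi>) \<longleftrightarrow> (\<exists>xs\<in>tuples m. sat M (xs @ e) \<phi>)"
proof (induction m arbitrary: e)
  case 0
  then show ?case by (simp add: tuples_def)
next
  case (Suc m)
  have "(\<exists>x\<in>carrier M. \<exists>xs\<in>tuples m. sat M (xs @ x # e) \<phi>) \<longleftrightarrow>
        (\<exists>xs\<in>tuples (Suc m). sat M (xs @ e) \<phi>)" (is "?l = ?r")
  proof
    assume ?l
    then obtain x xs where "x \<in> carrier M" "xs \<in> tuples m" "sat M (xs @ x # e) \<phi>" by blast
    \<comment> \<open>The outermost quantifier pushes its value first, so this value ends up last in
      the block.\<close>
    then show ?r by (intro bexI[of _ "xs @ [x]"]) (auto simp: tuples_def)
  next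
    assume ?r
    then obtain ys where ys: "ys \<in> tuples (Suc m)" "sat M (ys @ e) \<phi>" by blast
    then obtain xs x where "ys = xs @ [x]"
      by (cases ys rule: rev_cases) (auto simp: tuples_def)
    with ys show ?l by (intro bexI[of _ x] bexI[of _ xs]) (auto simp: tuples_def)
  qed
  then show ?case by (simp add: Suc)
qed

lemma wf_Exi_funpow: "wf_fm L k ((Exi ^^ m) \<phi>) \<longleftrightarrow> wf_fm L (m + k) \<phi>"
  by (induction m arbitrary: k) auto

text \<open>Predicates live on an arbitrary type of environments \<open>e \<in> S\<close>, which \<open>h\<close> encodes as tuples;
  binding a further variable replaces \<open>S\<close> by \<open>S \<times> X\<close> and prepends the new block.\<close>

definition dpred :: "nat \<Rightarrow> ('e \<Rightarrow> 'u list) \<Rightarrow> 'e set \<Rightarrow> ('e \<Rightarrow> bool) \<Rightarrow> bool" where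
  "dpred n h S P \<longleftrightarrow> h \<in> S \<rightarrow> tuples n \<and>
     (\<exists>\<phi> as. set as \<subseteq> carrier M \<and> wf_fm L (n + length as) \<phi> \<and>
        (\<forall>e\<in>S. P e \<longleftrightarrow> sat M (h e @ as) \<phi>))"

abbreviation ext :: "('e \<Rightarrow> 'u list) \<Rightarrow> 'e \<times> 'u list \<Rightarrow> 'u list" where
  "ext h \<equiv> \<lambda>p. snd p @ h (fst p)"

text \<open>\<open>definable\<close> hides the arity, which is ambiguous for the empty set. Here it
  is explicit, since block lengths must be known to split concatenated tuples.\<close>

definition dfbl :: "nat \<Rightarrow> 'u list set \<Rightarrow> bool" where
  "dfbl n X \<longleftrightarrow> X \<subseteq> tuples n \<and> dpred n (\<lambda>x. x) (tuples n) (\<lambda>x. x \<in> X)"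

text \<open>Functions such as the group inverse are not terms of the language; they enter formulas
  through their graphs, with the block of the value in front of the environment.\<close>

definition dfun :: "nat \<Rightarrow> ('e \<Rightarrow> 'u list) \<Rightarrow> 'e set \<Rightarrow> nat \<Rightarrow> ('e \<Rightarrow> 'u list) \<Rightarrow> bool" where
  "dfun n h S m t \<longleftrightarrow> h \<in> S \<rightarrow> tuples n \<and> t \<in> S \<rightarrow> tuples m \<and>
     dpred (m + n) (ext h) (S \<times> tuples m) (\<lambda>p. snd p = t (fst p))"

text \<open>Selections of coordinates are the functions that can be substituted into a formula by
  renaming alone, without a quantifier.\<close>

definition dsel :: "nat \<Rightarrow> ('e \<Rightarrow> 'u list) \<Rightarrow> 'e set \<Rightarrow> nat \<Rightarrow> ('e \<Rightarrow> 'u list) \<Rightarrow> bool" where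
  "dsel n h S m t \<longleftrightarrow> h \<in> S \<rightarrow> tuples n \<and>
     (\<exists>is. length is = m \<and> set is \<subseteq> {..<n} \<and> (\<forall>e\<in>S. t e = map ((!) (h e)) is))"

lemma tuples_append: "x \<in> tuples m \<Longrightarrow> y \<in> tuples n \<Longrightarrow> x @ y \<in> tuples (m + n)"
  by (auto simp: tuples_def)

lemma tuples_length: "x \<in> tuples m \<Longrightarrow> length x = m"
  by (simp add: tuples_def)

lemma dpred_cong: "dpred n h S P \<Longrightarrow> (\<And>e. e \<in> S \<Longrightarrow> P e = Q e) \<Longrightarrow> dpred n h S Q"
  by (auto simp: dpred_def)

lemma dpred_mono: "dpred n h S P \<Longrightarrow> S' \<subseteq> S \<Longrightarrow> dpred n h S' P"
  unfolding dpred_def by blast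

text \<open>Both formulas receive the list \<open>as @ bs\<close>. The parameters of
  \<open>\<psi>\<close> then sit behind \<open>as\<close>, so its indices from \<open>k\<close> on
  move up by \<open>length as\<close>; those of \<open>\<phi>\<close> keep their places.\<close>

lemma common_parameters:
  assumes "set as \<subseteq> carrier M" "wf_fm L (n + length as) \<phi>"
    and "set bs \<subseteq> carrier M" "wf_fm L (k + length bs) \<psi>"
  obtains cs \<phi>' \<psi>' where "set cs \<subseteq> carrier M" "wf_fm L (n + length cs) \<phi>'"
    "wf_fm L (k + length cs) \<psi>'" "\<And>e. length e = n \<Longrightarrow> sat M (e @ cs) \<phi>' = sat M (e @ as) \<phi>"
    "\<And>e. length e = k \<Longrightarrow> sat M (e @ cs) \<psi>' = sat M (e @ bs) \<psi>"
proof
  let ?cs = "as @ bs" and ?\<sigma> = "\<lambda>i. if i < k then i else length as + i"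
  show "set ?cs \<subseteq> carrier M" using assms by simp
  show "wf_fm L (n + length ?cs) (ren_fm id \<phi>)"
    using assms by (auto intro!: wf_ren_fm)
  show "wf_fm L (k + length ?cs) (ren_fm ?\<sigma> \<psi>)"
    using assms(4) by (auto intro!: wf_ren_fm)
  show "sat M (e @ ?cs) (ren_fm id \<phi>) = sat M (e @ as) \<phi>" if "length e = n" for e
    using assms that by (intro sat_ren_fm) (auto simp: nth_append)
  show "sat M (e @ ?cs) (ren_fm ?\<sigma> \<psi>) = sat M (e @ bs) \<psi>" if "length e = k" for e
    using assms(4) that by (intro sat_ren_fm) (auto simp: nth_append)
qed

lemma dpred_conj:
  assumes "dpred n h S P" "dpred n h S Q"
  shows "dpred n h S (\<lambda>e. P e \<and> Q e)"
proof -
  obtain \<phi> as \<psi> bs where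
    h: "h \<in> S \<rightarrow> tuples n" and
    as: "set as \<subseteq> carrier M" "wf_fm L (n + length as) \<phi>" and
    P: "\<forall>e\<in>S. P e \<longleftrightarrow> sat M (h e @ as) \<phi>" and
    bs: "set bs \<subseteq> carrier M" "wf_fm L (n + length bs) \<psi>" and
    Q: "\<forall>e\<in>S. Q e \<longleftrightarrow> sat M (h e @ bs) \<psi>"
    using assms by (auto simp: dpred_def)
  obtain cs \<phi>' \<psi>' where "set cs \<subseteq> carrier M" "wf_fm L (n + length cs) \<phi>'"
    "wf_fm L (n + length cs) \<psi>'" "\<And>e. length e = n \<Longrightarrow> sat M (e @ cs) \<phi>' = sat M (e @ as) \<phi>"
    "\<And>e. length e = n \<Longrightarrow> sat M (e @ cs) \<psi>' = sat M (e @ bs) \<psi>"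
    using common_parameters[OF as bs] by metis
  then show ?thesis using h P Q unfolding dpred_def
    by (intro conjI exI[of _ "Conj \<phi>' \<psi>'"] exI[of _ cs]) (auto simp: tuples_def Pi_iff)
qed

lemma dsel_range:
  assumes "dsel n h S m t"
  shows "t \<in> S \<rightarrow> tuples m"
proof
  fix e
  assume e: "e \<in> S"
  obtain "is" where "is": "length is = m" "set is \<subseteq> {..<n}" "\<forall>e\<in>S. t e = map ((!) (h e)) is"
    and h: "h \<in> S \<rightarrow> tuples n"
    using assms by (auto simp: dsel_def)
  have he: "h e \<in> tuples n" using h e by auto
  have te: "t e = map ((!) (h e)) is" using "is" e by blast
  have "set (t e) \<subseteq> set (h e)"
    using te "is"(2) he by (auto simp: tuples_def)
  then show "t e \<in> tuples m" using he "is"(1) te by (auto simp: tuples_def)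
qed

text \<open>Substitution as renaming: variable \<open>i < m\<close> becomes coordinate
  \<open>is ! i\<close> of the environment, and the parameter variables move from offset
  \<open>m\<close> to offset \<open>n\<close>.\<close>

lemma dpred_sel:
  assumes X: "dfbl m X" and t: "dsel n h S m t"
  shows "dpred n h S (\<lambda>e. t e \<in> X)"
proof -
  obtain "is" where "is": "length is = m" "set is \<subseteq> {..<n}" "\<forall>e\<in>S. t e = map ((!) (h e)) is"
    and h: "h \<in> S \<rightarrow> tuples n"
    using t by (auto simp: dsel_def)
  obtain \<phi> as where \<phi>: "set as \<subseteq> carrier M" "wf_fm L (m + length as) \<phi>"
    "\<forall>x\<in>tuples m. x \<in> X \<longleftrightarrow> sat M (x @ as) \<phi>"
    using X by (auto simp: dfbl_def dpred_def)
  define \<sigma> where "\<sigma> i = (if i < m then is ! i else n + (i - m))" for i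
  have isn: "is ! i < n" if "i < m" for i using "is" that nth_mem by blast
  have "wf_fm L (n + length as) (ren_fm \<sigma> \<phi>)"
    using \<phi>(2) by (rule wf_ren_fm) (auto simp: \<sigma>_def dest!: isn)
  moreover have "t e \<in> X \<longleftrightarrow> sat M (h e @ as) (ren_fm \<sigma> \<phi>)" if "e \<in> S" for e
  proof -
    have he: "h e \<in> tuples n" using h that by auto
    have te: "t e = map ((!) (h e)) is" using "is" that by blast
    have "t e \<in> tuples m" using dsel_range[OF t] that by auto
    moreover have "sat M (h e @ as) (ren_fm \<sigma> \<phi>) = sat M (t e @ as) \<phi>"
      using \<phi>(2) by (rule sat_ren_fm)
        (use he "is"(1) isn in \<open>auto simp: \<sigma>_def te nth_append tuples_def\<close>)
    ultimately show ?thesis using \<phi>(3) by simp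
  qed
  ultimately show ?thesis using h \<phi>(1) unfolding dpred_def by blast
qed

lemma dsel_env: "h \<in> S \<rightarrow> tuples n \<Longrightarrow> dsel n h S n h"
  unfolding dsel_def by (intro conjI exI[of _ "[0..<n]"]) (auto intro!: nth_equalityI simp: tuples_def Pi_iff)

lemma ext_enc: "h \<in> S \<rightarrow> tuples n \<Longrightarrow> X \<subseteq> tuples m \<Longrightarrow> ext h \<in> S \<times> X \<rightarrow> tuples (m + n)"
  by (auto intro!: tuples_append)

lemma dsel_snd:
  assumes "h \<in> S \<rightarrow> tuples n" "X \<subseteq> tuples m"
  shows "dsel (m + n) (ext h) (S \<times> X) m snd"
  unfolding dsel_def using assms ext_enc[OF assms]
  by (intro conjI exI[of _ "[0..<m]"])
     (auto intro!: nth_equalityI simp: nth_append tuples_def Pi_iff)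

lemma dsel_fst:
  assumes "dsel n h S k t" "X \<subseteq> tuples m"
  shows "dsel (m + n) (ext h) (S \<times> X) k (\<lambda>p. t (fst p))"
proof -
  obtain "is" where "is": "length is = k" "set is \<subseteq> {..<n}" "\<forall>e\<in>S. t e = map ((!) (h e)) is"
    and h: "h \<in> S \<rightarrow> tuples n"
    using assms by (auto simp: dsel_def)
  have "t e = map ((!) (x @ h e)) (map ((+) m) is)" if "e \<in> S" "x \<in> X" for e x
    using "is" that assms(2) by (auto simp: nth_append tuples_def)
  then show ?thesis unfolding dsel_def
    using "is" ext_enc[OF h assms(2)] by (intro conjI exI[of _ "map ((+) m) is"]) auto
qed

lemma dsel_append:
  assumes "dsel n h S k t" "dsel n h S l u"
  shows "dsel n h S (k + l) (\<lambda>e. t e @ u e)"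
proof -
  obtain "is" js where "length is = k" "set is \<subseteq> {..<n}" "\<forall>e\<in>S. t e = map ((!) (h e)) is"
    "h \<in> S \<rightarrow> tuples n" "length js = l" "set js \<subseteq> {..<n}" "\<forall>e\<in>S. u e = map ((!) (h e)) js"
    using assms by (auto simp: dsel_def)
  then show ?thesis unfolding dsel_def by (intro conjI exI[of _ "is @ js"]) auto
qed

lemma dfbl_subset: "dfbl n X \<Longrightarrow> X \<subseteq> tuples n"
  by (simp add: dfbl_def)

lemma dfbl_tuples: "dfbl n (tuples n)"
  unfolding dfbl_def dpred_def
  by (intro conjI exI[of _ "eq_block 0 0"] exI[of _ "[]"]) auto

lemma dfbl_singleton: "c \<in> tuples n \<Longrightarrow> dfbl n {c}"
  unfolding dfbl_def dpred_def
  by (intro conjI exI[of _ "eq_block n n"] exI[of _ c])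
     (auto simp: tuples_def sat_eq_block nth_append list_eq_iff_nth_eq intro: wf_eq_block)

lemma dfbl_diag: "dfbl (n + n) {x @ x | x. x \<in> tuples n}"
proof -
  have *: "(\<exists>x. e = x @ x \<and> x \<in> tuples n) \<longleftrightarrow> (\<forall>i<n. e ! i = e ! (n + i))" if "e \<in> tuples (n + n)" for e
  proof
    assume "\<forall>i<n. e ! i = e ! (n + i)"
    then have "take n e = drop n e"
      using that by (intro nth_equalityI) (auto simp: tuples_def)
    moreover have "take n e \<in> tuples n" using that set_take_subset[of n e] by (auto simp: tuples_def)
    ultimately show "\<exists>x. e = x @ x \<and> x \<in> tuples n" by (metis append_take_drop_id)
  qed (auto simp: nth_append tuples_def)
  show ?thesis
    unfolding dfbl_def dpred_def
    by (intro conjI exI[of _ "eq_block n n"] exI[of _ "[]"])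
       (use * in \<open>auto simp: sat_eq_block intro: wf_eq_block tuples_append\<close>)
qed

text \<open>A formula witnessing \<open>dpred\<close> is unconstrained off the domain, so it may
  hold for blocks outside \<open>X\<close>. Conjoining membership in \<open>X\<close> makes the
  equivalence valid on all tuples, over which \<open>Exi\<close> ranges.\<close>

lemma dpred_relativize:
  assumes X: "dfbl m X" and h: "h \<in> S \<rightarrow> tuples n"
    and P: "dpred (m + n) (ext h) (S \<times> X) P"
  shows "dpred (m + n) (ext h) (S \<times> tuples m) (\<lambda>p. snd p \<in> X \<and> P p)"
proof -
  have 1: "dpred (m + n) (ext h) (S \<times> tuples m) (\<lambda>p. snd p \<in> X)"
    using X by (rule dpred_sel) (rule dsel_snd[OF h subset_refl])
  obtain \<phi> as where \<phi>: "set as \<subseteq> carrier M" "wf_fm L ((m + n) + length as) \<phi>"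
    "\<forall>p\<in>S \<times> X. P p \<longleftrightarrow> sat M (ext h p @ as) \<phi>"
    using P by (auto simp: dpred_def)
  have 2: "dpred (m + n) (ext h) (S \<times> tuples m) (\<lambda>p. sat M (ext h p @ as) \<phi>)"
    using \<phi> ext_enc[OF h subset_refl] unfolding dpred_def by blast
  show ?thesis
    by (rule dpred_cong[OF dpred_conj[OF 1 2]]) (use \<phi> in auto)
qed

lemma dpred_ex:
  assumes X: "dfbl m X" and h: "h \<in> S \<rightarrow> tuples n"
    and P: "dpred (m + n) (ext h) (S \<times> X) (\<lambda>p. P (fst p) (snd p))"
  shows "dpred n h S (\<lambda>e. \<exists>x\<in>X. P e x)"
proof -
  obtain \<phi> as where \<phi>: "set as \<subseteq> carrier M" "wf_fm L ((m + n) + length as) \<phi>"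
    "\<forall>p\<in>S \<times> tuples m. snd p \<in> X \<and> P (fst p) (snd p) \<longleftrightarrow> sat M (ext h p @ as) \<phi>"
    using dpred_relativize[OF X h P] by (auto simp: dpred_def)
  have "(\<exists>x\<in>X. P e x) \<longleftrightarrow> sat M (h e @ as) ((Exi ^^ m) \<phi>)" if "e \<in> S" for e
    using that \<phi>(3) dfbl_subset[OF X] unfolding sat_Exi_funpow by fastforce
  moreover have "wf_fm L (n + length as) ((Exi ^^ m) \<phi>)"
    using \<phi>(2) by (simp add: wf_Exi_funpow add.assoc)
  ultimately show ?thesis using \<phi>(1) h unfolding dpred_def by blast
qed

text \<open>Changes the type of environments. The encoding of \<open>k e\<close> is a selection of
  coordinates from that of \<open>e\<close>, so the same formula works after renaming.\<close>

lemma dpred_reindex: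
  assumes P: "dpred n h S P" and k: "k \<in> S' \<rightarrow> S" and t: "dsel n' h' S' n (\<lambda>e. h (k e))"
  shows "dpred n' h' S' (\<lambda>e. P (k e))"
proof -
  obtain \<phi> as where \<phi>: "set as \<subseteq> carrier M" "wf_fm L (n + length as) \<phi>"
    "\<forall>e\<in>S. P e \<longleftrightarrow> sat M (h e @ as) \<phi>" "h \<in> S \<rightarrow> tuples n"
    using P by (auto simp: dpred_def)
  have "dfbl n {x \<in> tuples n. sat M (x @ as) \<phi>}"
    using \<phi> by (auto simp: dfbl_def dpred_def)
  from dpred_sel[OF this t] show ?thesis
    by (rule dpred_cong) (use \<phi> k in auto)
qed

section \<open>Definable functions\<close>

lemma dfun_sel:
  assumes t: "dsel n h S m t"
  shows "dfun n h S m t"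
proof -
  have h: "h \<in> S \<rightarrow> tuples n" using t by (simp add: dsel_def)
  have tS: "t \<in> S \<rightarrow> tuples m"
    using t by (rule dsel_range)
  have "x @ y \<in> {z @ z | z. z \<in> tuples m} \<longleftrightarrow> x = y" if "x \<in> tuples m" "y \<in> tuples m" for x y
  proof
    assume "x @ y \<in> {z @ z | z. z \<in> tuples m}"
    then obtain z where "x @ y = z @ z" "z \<in> tuples m" by blast
    then show "x = y" using that by (simp add: tuples_length)
  qed (use that in blast)
  then have "dpred (m + n) (ext h) (S \<times> tuples m) (\<lambda>p. snd p = t (fst p))"
    by (rule dpred_cong[OF dpred_sel[OF dfbl_diag
          dsel_append[OF dsel_snd[OF h subset_refl] dsel_fst[OF t subset_refl]]]])
       (use tS in auto)
  then show ?thesis using h tS by (simp add: dfun_def)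
qed

lemma dfun_env: "h \<in> S \<rightarrow> tuples n \<Longrightarrow> dfun n h S n h"
  by (rule dfun_sel[OF dsel_env])

lemma dfun_snd: "h \<in> S \<rightarrow> tuples n \<Longrightarrow> X \<subseteq> tuples m \<Longrightarrow> dfun (m + n) (ext h) (S \<times> X) m snd"
  by (rule dfun_sel[OF dsel_snd])

lemma dfun_const:
  assumes h: "h \<in> S \<rightarrow> tuples n" and c: "c \<in> tuples m"
  shows "dfun n h S m (\<lambda>e. c)"
proof -
  have "dpred (m + n) (ext h) (S \<times> tuples m) (\<lambda>p. snd p \<in> {c})"
    by (rule dpred_sel[OF dfbl_singleton[OF c] dsel_snd[OF h subset_refl]])
  then show ?thesis using h c by (simp add: dfun_def)
qed

lemma dfun_fst:
  assumes t: "dfun n h S k t" and X: "X \<subseteq> tuples m"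
  shows "dfun (m + n) (ext h) (S \<times> X) k (\<lambda>p. t (fst p))"
proof -
  have h: "h \<in> S \<rightarrow> tuples n" "t \<in> S \<rightarrow> tuples k"
    and P: "dpred (k + n) (ext h) (S \<times> tuples k) (\<lambda>p. snd p = t (fst p))"
    using t by (auto simp: dfun_def)
  have "dpred (k + (m + n)) (ext (ext h)) ((S \<times> X) \<times> tuples k)
      (\<lambda>q. snd (fst (fst q), snd q) = t (fst (fst (fst q), snd q)))"
  proof (rule dpred_reindex[OF P])
    show "(\<lambda>q. (fst (fst q), snd q)) \<in> (S \<times> X) \<times> tuples k \<rightarrow> S \<times> tuples k" by auto
    show "dsel (k + (m + n)) (ext (ext h)) ((S \<times> X) \<times> tuples k) (k + n)
       (\<lambda>q. ext h (fst (fst q), snd q))"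
      unfolding fst_conv snd_conv
      by (intro dsel_append dsel_snd dsel_fst[OF dsel_fst] dsel_env ext_enc h X subset_refl)
  qed
  then show ?thesis using h X by (auto simp: dfun_def intro!: tuples_append)
qed

lemma dpred_in:
  assumes t: "dfun n h S m t" and X: "dfbl m X"
  shows "dpred n h S (\<lambda>e. t e \<in> X)"
proof -
  have h: "h \<in> S \<rightarrow> tuples n" "t \<in> S \<rightarrow> tuples m"
    and P: "dpred (m + n) (ext h) (S \<times> tuples m) (\<lambda>p. snd p = t (fst p))"
    using t by (auto simp: dfun_def)
  have "dpred n h S (\<lambda>e. \<exists>x\<in>X. x = t e)"
    by (rule dpred_ex[OF X h(1)]) (rule dpred_mono[OF P], use dfbl_subset[OF X] in auto)
  then show ?thesis by (rule dpred_cong) auto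
qed

lemma dpred_eq:
  assumes t: "dfun n h S m t" and u: "dfun n h S m u"
  shows "dpred n h S (\<lambda>e. t e = u e)"
proof -
  have h: "h \<in> S \<rightarrow> tuples n" "t \<in> S \<rightarrow> tuples m"
    using t by (auto simp: dfun_def)
  have "dpred n h S (\<lambda>e. \<exists>x\<in>tuples m. x = t e \<and> x = u e)"
    by (rule dpred_ex[OF dfbl_tuples h(1)], rule dpred_conj) (use t u in \<open>auto simp: dfun_def\<close>)
  then show ?thesis by (rule dpred_cong) (use h in auto)
qed

text \<open>Only the graph of \<open>f\<close> is definable, so the arguments are bound as
  \<open>x = t e\<close> and \<open>y = u e\<close> and then tested in the graph together with the
  value. Multiplication and the action enter formulas this way.\<close>

lemma dfun_op:
  assumes graph: "dfbl (k + (l + m)) {x @ y @ f x y | x y. x \<in> X \<and> y \<in> Y}"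
    and X: "dfbl k X" and Y: "dfbl l Y"
    and f: "\<And>x y. x \<in> X \<Longrightarrow> y \<in> Y \<Longrightarrow> f x y \<in> tuples m"
    and t: "dfun n h S k t" "\<And>e. e \<in> S \<Longrightarrow> t e \<in> X"
    and u: "dfun n h S l u" "\<And>e. e \<in> S \<Longrightarrow> u e \<in> Y"
  shows "dfun n h S m (\<lambda>e. f (t e) (u e))"
proof -
  let ?F = "{x @ y @ f x y | x y. x \<in> X \<and> y \<in> Y}"
  have h: "h \<in> S \<rightarrow> tuples n" using t by (auto simp: dfun_def)
  note sub = dfbl_subset[OF X] dfbl_subset[OF Y] subset_refl
  have "dpred (m + n) (ext h) (S \<times> tuples m)
     (\<lambda>p. \<exists>x\<in>X. \<exists>y\<in>Y. (x = t (fst p) \<and> y = u (fst p)) \<and> x @ y @ snd p \<in> ?F)"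
    by (intro dpred_ex[OF X] dpred_ex[OF Y] dpred_conj dpred_sel[OF graph] dpred_eq[of _ _ _ k] dpred_eq[of _ _ _ l]
          ext_enc h sub dsel_append dsel_snd
          dsel_fst[OF dsel_snd] dsel_fst[OF dsel_fst[OF dsel_snd]]
          dfun_snd dfun_fst[OF dfun_snd] dfun_fst[OF dfun_fst[OF dfun_fst]] t(1) u(1))
  then have "dpred (m + n) (ext h) (S \<times> tuples m) (\<lambda>p. snd p = f (t (fst p)) (u (fst p)))"
  proof (rule dpred_cong)
    fix p assume p: "p \<in> S \<times> tuples m"
    have "x @ y @ z \<in> ?F \<longleftrightarrow> z = f x y" if "x \<in> X" "y \<in> Y" for x y z
    proof -
      \<comment> \<open>All blocks have known length, so concatenation is injective and a point of
        the graph determines its arguments and value.\<close>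
      have "x = x' \<and> y = y' \<and> z = f x' y'" if "x @ y @ z = x' @ y' @ f x' y'" "x' \<in> X" "y' \<in> Y" for x' y'
      proof -
        have "length x = length x'" "length y = length y'"
          using that \<open>x \<in> X\<close> \<open>y \<in> Y\<close> sub by (auto simp: tuples_def subset_iff)
        then show ?thesis using that by simp
      qed
      then show ?thesis using that by blast
    qed
    then show "(\<exists>x\<in>X. \<exists>y\<in>Y. (x = t (fst p) \<and> y = u (fst p)) \<and> x @ y @ snd p \<in> ?F) \<longleftrightarrow>
        snd p = f (t (fst p)) (u (fst p))"
      using p t(2) u(2) by auto
  qed
  then show ?thesis using h f t(2) u(2) by (auto simp: dfun_def)
qed

lemma dfun_comp:
  assumes \<phi>: "dfun m (\<lambda>x. x) X k \<phi>" and X: "dfbl m X"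
    and t: "dfun n h S m t" "\<And>e. e \<in> S \<Longrightarrow> t e \<in> X"
  shows "dfun n h S k (\<lambda>e. \<phi> (t e))"
proof -
  have h: "h \<in> S \<rightarrow> tuples n" using t by (auto simp: dfun_def)
  note sub = dfbl_subset[OF X] subset_refl
  have \<phi>': "\<phi> \<in> X \<rightarrow> tuples k" "dpred (k + m) (ext (\<lambda>x. x)) (X \<times> tuples k) (\<lambda>p. snd p = \<phi> (fst p))"
    using \<phi> by (auto simp: dfun_def)
  have graph: "dpred (m + (k + n)) (ext (ext h)) ((S \<times> tuples k) \<times> X)
      (\<lambda>q. snd (snd q, snd (fst q)) = \<phi> (fst (snd q, snd (fst q))))"
  proof (rule dpred_reindex[OF \<phi>'(2)])
    show "(\<lambda>q. (snd q, snd (fst q))) \<in> (S \<times> tuples k) \<times> X \<rightarrow> X \<times> tuples k" by auto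
    show "dsel (m + (k + n)) (ext (ext h)) ((S \<times> tuples k) \<times> X) (k + m)
       (\<lambda>q. ext (\<lambda>x. x) (snd q, snd (fst q)))"
      unfolding fst_conv snd_conv
      by (intro dsel_append dsel_snd dsel_fst[OF dsel_snd] ext_enc h sub)
  qed
  have "dpred (k + n) (ext h) (S \<times> tuples k) (\<lambda>p. \<exists>x\<in>X. x = t (fst p) \<and> snd p = \<phi> x)"
    by (intro dpred_ex[OF X] dpred_conj graph[unfolded fst_conv snd_conv] dpred_eq[of _ _ _ m]
          dfun_snd dfun_fst[OF dfun_fst] t(1) ext_enc h sub)
  then have "dpred (k + n) (ext h) (S \<times> tuples k) (\<lambda>p. snd p = \<phi> (t (fst p)))"
    by (rule dpred_cong) (use t(2) in auto)
  then show ?thesis using h \<phi>'(1) t(2) by (auto simp: dfun_def)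
qed

section \<open>From definable predicates back to definable and interpretable sets\<close>

lemma dfbl_collect:
  assumes X: "dfbl n X" and P: "dpred n (\<lambda>x. x) X P"
  shows "dfbl n {x \<in> X. P x}"
proof -
  obtain \<phi> as where \<phi>: "set as \<subseteq> carrier M" "wf_fm L (n + length as) \<phi>"
    "\<forall>x\<in>X. P x \<longleftrightarrow> sat M (x @ as) \<phi>"
    using P by (auto simp: dpred_def)
  have "dpred n (\<lambda>x. x) (tuples n) (\<lambda>x. sat M (x @ as) \<phi>)"
    using \<phi> by (auto simp: dpred_def)
  from dpred_conj[OF _ this, of "\<lambda>x. x \<in> X"] have "dpred n (\<lambda>x. x) (tuples n) (\<lambda>x. x \<in> X \<and> P x)"
    using X \<phi>(3) by (auto simp: dfbl_def elim: dpred_cong)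
  then show ?thesis using X by (auto simp: dfbl_def)
qed

text \<open>The domain is \<open>Y \<times> X\<close> because the block bound last is prepended:
  \<open>ext\<close> encodes the pair \<open>(y, x)\<close> as \<open>x @ y\<close>.\<close>

lemma dfbl_collect2:
  assumes X: "dfbl m X" and Y: "dfbl n Y"
    and P: "dpred (m + n) (ext (\<lambda>y. y)) (Y \<times> X) (\<lambda>p. P (snd p) (fst p))"
  shows "dfbl (m + n) {x @ y | x y. x \<in> X \<and> y \<in> Y \<and> P x y}"
proof -
  have id: "(\<lambda>y. y) \<in> S \<rightarrow> tuples n" if "S \<subseteq> tuples n" for S n using that by auto
  note sub = dfbl_subset[OF X] dfbl_subset[OF Y]
  obtain \<phi> as where \<phi>: "set as \<subseteq> carrier M" "wf_fm L ((m + n) + length as) \<phi>"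
    "\<forall>p\<in>Y \<times> X. P (snd p) (fst p) \<longleftrightarrow> sat M ((snd p @ fst p) @ as) \<phi>"
    using P unfolding dpred_def by blast
  have "dpred (m + n) (\<lambda>z. z) (tuples (m + n))
      (\<lambda>z. \<exists>y\<in>Y. \<exists>x\<in>X. z = x @ y \<and> sat M (z @ as) \<phi>)"
  proof (rule dpred_ex[OF Y] dpred_ex[OF X] | rule id | rule ext_enc | rule sub | rule subset_refl | rule dpred_conj)+
    show "dpred (m + (n + (m + n))) (ext (ext (\<lambda>y. y))) ((tuples (m + n) \<times> Y) \<times> X)
      (\<lambda>p. fst (fst p) = snd p @ snd (fst p))"
      by (intro dpred_eq[of _ _ _ "m + n"] dfun_sel dsel_fst[OF dsel_fst[OF dsel_env]] dsel_append
          dsel_snd dsel_fst[OF dsel_snd] ext_enc id sub subset_refl)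
    have "dpred (m + n) (\<lambda>z. z) (tuples (m + n)) (\<lambda>z. sat M (z @ as) \<phi>)"
      using \<phi> by (auto simp: dpred_def)
    then show "dpred (m + (n + (m + n))) (ext (ext (\<lambda>y. y))) ((tuples (m + n) \<times> Y) \<times> X)
      (\<lambda>p. sat M (fst (fst p) @ as) \<phi>)"
      by (rule dpred_reindex)
         (auto intro!: dsel_fst[OF dsel_fst[OF dsel_env]] id sub)
  qed
  moreover have "(\<exists>y\<in>Y. \<exists>x\<in>X. z = x @ y \<and> sat M (z @ as) \<phi>) \<longleftrightarrow>
      z \<in> {x @ y | x y. x \<in> X \<and> y \<in> Y \<and> P x y}" for z
  proof -
    have "P x y \<longleftrightarrow> sat M ((x @ y) @ as) \<phi>" if "x \<in> X" "y \<in> Y" for x y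
      using \<phi>(3) that by force
    then show ?thesis by blast
  qed
  ultimately show ?thesis using sub by (auto simp: dfbl_def intro: tuples_append)
qed

lemma dfbl_definable:
  assumes "dfbl n X"
  shows "definable L M X"
proof -
  obtain \<phi> as where \<phi>: "set as \<subseteq> carrier M" "wf_fm L (n + length as) \<phi>"
    "\<forall>x\<in>tuples n. x \<in> X \<longleftrightarrow> sat M (x @ as) \<phi>"
    using assms by (auto simp: dfbl_def dpred_def)
  then have "X = dset M n \<phi> as"
    using dfbl_subset[OF assms] by (auto simp: dset_def tuples_def)
  then show ?thesis using \<phi> by (auto simp: definable_def)
qed

text \<open>A nonempty set contains a tuple, whose length pins down the arity hidden in
  \<open>definable\<close>.\<close>

lemma definable_dfbl:
  assumes "definable L M X" "X \<noteq> {}" "X \<subseteq> tuples n"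
  shows "dfbl n X"
proof -
  obtain m \<phi> as where "set as \<subseteq> carrier M" "wf_fm L (m + length as) \<phi>" "X = dset M m \<phi> as"
    using assms by (auto simp: definable_def)
  moreover from this have "m = n" using assms by (auto simp: dset_def tuples_def)
  ultimately show ?thesis by (auto simp: dfbl_def dpred_def dset_def tuples_def)
qed

lemma definable_arity:
  assumes "definable L M X"
  obtains n where "X \<subseteq> tuples n"
  using assms that by (auto simp: definable_def dset_def tuples_def)

text \<open>\<open>is_interp\<close> demands one parameter list for both the set and the equivalence
  relation, whence \<open>common_parameters\<close>. As all tuples in \<open>X\<close> have length
  \<open>n\<close>, the pair \<open>(x, y)\<close> can be recovered from
  \<open>x @ y\<close>.\<close>

lemma interpretable_quotient:
  assumes X: "dfbl n X" and E: "dfbl (n + n) {x @ y | x y. (x, y) \<in> E}" and eq: "equiv X E"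
  shows "interpretable L M (X // E)"
proof -
  have EX: "E \<subseteq> X \<times> X" using eq by (rule equiv_type)
  obtain \<phi> as where as: "set as \<subseteq> carrier M" "wf_fm L (n + length as) \<phi>" and
    \<phi>: "\<forall>x\<in>tuples n. x \<in> X \<longleftrightarrow> sat M (x @ as) \<phi>"
    using X by (auto simp: dfbl_def dpred_def)
  obtain \<psi> bs where bs: "set bs \<subseteq> carrier M" "wf_fm L ((n + n) + length bs) \<psi>" and
    \<psi>: "\<forall>z\<in>tuples (n + n). z \<in> {x @ y | x y. (x, y) \<in> E} \<longleftrightarrow> sat M (z @ bs) \<psi>"
    using E by (auto simp: dfbl_def dpred_def)
  obtain cs \<phi>' \<psi>' where cs: "set cs \<subseteq> carrier M" "wf_fm L (n + length cs) \<phi>'"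
    "wf_fm L ((n + n) + length cs) \<psi>'" "\<And>e. length e = n \<Longrightarrow> sat M (e @ cs) \<phi>' = sat M (e @ as) \<phi>"
    "\<And>e. length e = n + n \<Longrightarrow> sat M (e @ cs) \<psi>' = sat M (e @ bs) \<psi>"
    using common_parameters[OF as bs] by metis
  have 1: "dset M n \<phi>' cs = X"
    using \<phi> dfbl_subset[OF X] cs(4) by (auto simp: dset_def tuples_def)
  have *: "(x, y) \<in> E \<longleftrightarrow> sat M ((x @ y) @ cs) \<psi>'" if "x \<in> tuples n" "y \<in> tuples n" for x y
  proof -
    have "x = x' \<and> y = y'" if "x @ y = x' @ y'" "(x', y') \<in> E" for x' y'
    proof -
      have "length x' = length x"
        using that(2) \<open>x \<in> tuples n\<close> EX dfbl_subset[OF X] by (auto simp: tuples_def)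
      then show ?thesis using that(1) by simp
    qed
    then have "(x, y) \<in> E \<longleftrightarrow> x @ y \<in> {x @ y | x y. (x, y) \<in> E}" by blast
    also have "\<dots> \<longleftrightarrow> sat M ((x @ y) @ bs) \<psi>" using \<psi> tuples_append[OF that] by blast
    also have "\<dots> \<longleftrightarrow> sat M ((x @ y) @ cs) \<psi>'"
      using cs(5)[of "x @ y"] that by (simp add: tuples_length)
    finally show ?thesis .
  qed
  have 2: "drel M n \<psi>' cs = E"
  proof -
    have "(x, y) \<in> drel M n \<psi>' cs \<longleftrightarrow> (x, y) \<in> E" for x y
    proof (cases "x \<in> tuples n \<and> y \<in> tuples n")
      case True
      then show ?thesis using * by (simp add: drel_def dset_def tuples_def)
    next
      case False
      then show ?thesis using EX dfbl_subset[OF X] by (auto simp: drel_def dset_def tuples_def)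
    qed
    then show ?thesis by auto
  qed
  have "is_interp L M n \<phi>' \<psi>' cs"
    using cs eq by (simp add: is_interp_def 1 2 mult_2)
  moreover have "X // E = iset M n \<phi>' \<psi>' cs" by (simp add: iset_def 1 2)
  ultimately show ?thesis unfolding interpretable_def by blast
qed

end

section \<open>Dimension of quotients\<close>

locale dim_structure = fo_structure L M for L :: "('f, 'r) lang" and M :: "('u, 'f, 'r) fo_struct" +
  fixes T :: "('f, 'r) fm set" and dim :: "('u, 'f, 'r) fo_struct \<Rightarrow> 'u list set set \<Rightarrow> nat"
  assumes model: "model L T M" and dimension: "is_dimension L T dim"
begin

lemma dim_eq_0: "interpretable L M X \<Longrightarrow> dim M X = 0 \<longleftrightarrow> finite X"
  using model dimension by (simp add: is_dimension_def)

text \<open>The map from \<open>X // E\<close> to \<open>Y // F\<close> is presented by an invariant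
  relation \<open>R\<close> on representatives that is total, single-valued modulo \<open>F\<close>
  and onto. Its graph lifted to representatives is \<open>R\<close> itself, the form asked for by
  \<open>interpretable_map\<close>, so no definable choice of representatives enters.\<close>

lemma dim_fibration:
  assumes X: "dfbl n X" "equiv X E" "dfbl (n + n) {x @ y | x y. (x, y) \<in> E}"
    and Y: "dfbl m Y" "equiv Y F" "dfbl (m + m) {x @ y | x y. (x, y) \<in> F}"
    and R: "dfbl (n + m) {x @ y | x y. x \<in> X \<and> y \<in> Y \<and> R x y}"
    and R_cong: "\<And>x x' y y'. R x y \<Longrightarrow> (x, x') \<in> E \<Longrightarrow> (y, y') \<in> F \<Longrightarrow> R x' y'"
    and R_total: "\<And>x. x \<in> X \<Longrightarrow> \<exists>y\<in>Y. R x y"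
    and R_fun: "\<And>x y y'. x \<in> X \<Longrightarrow> y \<in> Y \<Longrightarrow> y' \<in> Y \<Longrightarrow> R x y \<Longrightarrow> R x y' \<Longrightarrow> (y, y') \<in> F"
    and R_onto: "\<And>y. y \<in> Y \<Longrightarrow> \<exists>x\<in>X. R x y"
    and nonempty: "Y \<noteq> {}"
    and fibre: "\<And>y. y \<in> Y \<Longrightarrow>
       d \<le> dim M ({x \<in> X. R x y} // Restr E {x \<in> X. R x y})"
  shows "dim M (Y // F) + d \<le> dim M (X // E)"
proof -
  define f where "f c = {y \<in> Y. \<exists>x\<in>c. R x y}" for c
  have EX: "E \<subseteq> X \<times> X" and FY: "F \<subseteq> Y \<times> Y" using X(2) Y(2) by (auto dest: equiv_type)
  have reflE: "(x, x) \<in> E" if "x \<in> X" for x using X(2) that by (auto simp: equiv_def refl_on_def)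
  have reflF: "(y, y) \<in> F" if "y \<in> Y" for y using Y(2) that by (auto simp: equiv_def refl_on_def)
  have f_class: "f (E `` {x}) = {y \<in> Y. R x y}" if "x \<in> X" for x
  proof -
    have "R x y" if "(x, x') \<in> E" "R x' y" "y \<in> Y" for x' y
      using R_cong[OF that(2) _ reflF[OF that(3)]] that X(2) by (meson equivE symE)
    then show ?thesis using that reflE[OF that] unfolding f_def by blast
  qed
  have R_class: "{y' \<in> Y. R x y'} = F `` {y}" if "x \<in> X" "y \<in> Y" "R x y" for x y
    using R_cong[OF that(3) reflE[OF that(1)]] R_fun[OF that(1,2)] that FY by blast
  have f_in: "f c \<in> Y // F" if "c \<in> X // E" for c
  proof -
    obtain x where x: "x \<in> X" "c = E `` {x}" using \<open>c \<in> X // E\<close> by (auto elim!: quotientE)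
    obtain y where "y \<in> Y" "R x y" using R_total x by blast
    then show ?thesis using f_class R_class x by (simp add: quotientI)
  qed
  have onto: "\<exists>c\<in>X // E. c' = f c" if "c' \<in> Y // F" for c'
  proof -
    obtain y where y: "y \<in> Y" "c' = F `` {y}" using \<open>c' \<in> Y // F\<close> by (auto elim!: quotientE)
    obtain x where x: "x \<in> X" "R x y" using R_onto y by blast
    then have "c' = f (E `` {x})" using f_class R_class y by simp
    then show ?thesis using x(1) by (blast intro: quotientI)
  qed
  have image: "f ` (X // E) = Y // F"
    using f_in onto by blast
  have graph: "{xs @ ys | xs ys. \<exists>c\<in>X // E. xs \<in> c \<and> ys \<in> f c} =
      {x @ y | x y. x \<in> X \<and> y \<in> Y \<and> R x y}"
  proof -
    have "(\<exists>c\<in>X // E. x \<in> c \<and> y \<in> f c) \<longleftrightarrow> x \<in> X \<and> y \<in> Y \<and> R x y" for x y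
    proof
      assume "\<exists>c\<in>X // E. x \<in> c \<and> y \<in> f c"
      then obtain c where c: "c \<in> X // E" "x \<in> c" "y \<in> f c" by blast
      from c(1) obtain z where z: "z \<in> X" "c = E `` {z}" by (rule quotientE)
      then have "x \<in> X" using c(2) EX by auto
      moreover have "c = E `` {x}" using z c(2) equiv_class_eq[OF X(2)] by auto
      ultimately show "x \<in> X \<and> y \<in> Y \<and> R x y" using c(3) f_class by auto
    next
      assume *: "x \<in> X \<and> y \<in> Y \<and> R x y"
      show "\<exists>c\<in>X // E. x \<in> c \<and> y \<in> f c"
        by (rule bexI[of _ "E `` {x}"]) (use * f_class reflE in \<open>auto intro: quotientI\<close>)
    qed
    then show ?thesis by simp
  qed
  have fib: "d \<le> dim M {c \<in> X // E. f c = c'}" if "c' \<in> Y // F" for c'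
  proof -
    obtain y where y: "y \<in> Y" "c' = F `` {y}" using \<open>c' \<in> Y // F\<close> by (auto elim!: quotientE)
    let ?Z = "{x \<in> X. R x y}"
    have fx: "f (E `` {x}) = c' \<longleftrightarrow> x \<in> ?Z" if "x \<in> X" for x
    proof
      assume "f (E `` {x}) = c'"
      then have "y \<in> {y \<in> Y. R x y}" using f_class[OF that] y reflF[OF y(1)] by simp
      then show "x \<in> ?Z" using that by simp
    next
      assume "x \<in> ?Z"
      then show "f (E `` {x}) = c'" using f_class R_class[of x y] y by simp
    qed
    \<comment> \<open>\<open>?Z\<close> is a union of \<open>E\<close>-classes, so restricting
      \<open>E\<close> to it leaves these classes unchanged; this identifies the fibre over
      \<open>c'\<close> with a quotient of \<open>?Z\<close>.\<close>
    have class_Z: "E `` {x} = Restr E ?Z `` {x}" if "x \<in> ?Z" for x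
      using that R_cong[OF _ _ reflF[OF y(1)]] EX by blast
    have "{c \<in> X // E. f c = c'} = (\<lambda>x. E `` {x}) ` ?Z"
      using fx by (fastforce simp: quotient_def)
    also have "\<dots> = ?Z // Restr E ?Z"
      using class_Z by (auto simp: quotient_def)
    finally show ?thesis using fibre[OF y(1)] by simp
  qed
  have "interpretable_map L M (X // E) (Y // F) f"
    using f_in dfbl_definable[OF R] by (auto simp: interpretable_map_def graph)
  moreover have "interpretable L M (X // E)" "interpretable L M (Y // F)"
    using interpretable_quotient X Y by blast+
  moreover have "Y // F \<noteq> {}" using nonempty by (auto simp: quotient_def)
  ultimately show ?thesis
    using dimension model image fib unfolding is_dimension_def by blast
qed

text \<open>The case \<open>d = 0\<close> of the fibration inequality: the target of a definable
  surjection has at most the dimension of the source.\<close>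

lemma dim_bijection:
  assumes X: "dfbl n X" "equiv X E" "dfbl (n + n) {x @ y | x y. (x, y) \<in> E}"
    and Y: "dfbl m Y" "equiv Y F" "dfbl (m + m) {x @ y | x y. (x, y) \<in> F}"
    and R: "dfbl (n + m) {x @ y | x y. x \<in> X \<and> y \<in> Y \<and> R x y}"
    and "\<And>x x' y y'. R x y \<Longrightarrow> (x, x') \<in> E \<Longrightarrow> (y, y') \<in> F \<Longrightarrow> R x' y'"
    and "\<And>x. x \<in> X \<Longrightarrow> \<exists>y\<in>Y. R x y"
    and "\<And>x y y'. x \<in> X \<Longrightarrow> y \<in> Y \<Longrightarrow> y' \<in> Y \<Longrightarrow> R x y \<Longrightarrow> R x y' \<Longrightarrow> (y, y') \<in> F"
    and "\<And>y. y \<in> Y \<Longrightarrow> \<exists>x\<in>X. R x y"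
    and "Y \<noteq> {}"
  shows "dim M (Y // F) \<le> dim M (X // E)"
  using dim_fibration[where d = 0, OF assms] by simp

end

section \<open>Quotients of a definable abelian group\<close>

locale dim_comm_group = dim_structure L M T dim + comm_group A
  for L :: "('f, 'r) lang" and M :: "('u, 'f, 'r) fo_struct" and T dim and A :: "'u list monoid" (structure) +
  fixes k :: nat
  assumes dfbl_carrier: "dfbl k (carrier A)"
    and dfbl_mult: "dfbl (k + (k + k)) {x @ y @ (x \<otimes> y) | x y. x \<in> carrier A \<and> y \<in> carrier A}"
begin

lemma carrier_tuples: "carrier A \<subseteq> tuples k"
  using dfbl_carrier by (rule dfbl_subset)

lemma dfun_mult:
  assumes "dfun n h S k t" "\<And>e. e \<in> S \<Longrightarrow> t e \<in> carrier A"
    and "dfun n h S k u" "\<And>e. e \<in> S \<Longrightarrow> u e \<in> carrier A"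
  shows "dfun n h S k (\<lambda>e. t e \<otimes> u e)"
  using dfbl_mult dfbl_carrier dfbl_carrier _ assms
  by (rule dfun_op) (use carrier_tuples in auto)

text \<open>\<open>definable_group\<close> provides only the graph of multiplication; the inverse is
  defined as the solution \<open>x\<close> of \<open>t e \<otimes> x = \<one>\<close>.\<close>

lemma dfun_inv:
  assumes t: "dfun n h S k t" "\<And>e. e \<in> S \<Longrightarrow> t e \<in> carrier A"
  shows "dfun n h S k (\<lambda>e. inv (t e))"
proof -
  have h: "h \<in> S \<rightarrow> tuples n" using t by (simp add: dfun_def)
  have one: "\<one> \<in> tuples k" using carrier_tuples by auto
  have "dpred (k + n) (ext h) (S \<times> carrier A) (\<lambda>p. t (fst p) \<otimes> snd p = \<one>)"
    by (intro dpred_eq[of _ _ _ k] dfun_mult dfun_const dfun_fst[OF t(1)] dfun_snd ext_enc h carrier_tuples one)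
       (use t(2) in auto)
  from dpred_relativize[OF dfbl_carrier h this]
  have "dpred (k + n) (ext h) (S \<times> tuples k) (\<lambda>p. snd p = inv (t (fst p)))"
    by (rule dpred_cong) (use t(2) in \<open>auto intro: inv_equality[symmetric] simp: m_comm\<close>)
  then show ?thesis using h t(2) carrier_tuples by (auto simp: dfun_def)
qed

text \<open>The set \<open>X\<close> is not tied to being a subgroup: the fibres of B/C
  \<rightarrow> B/E are cosets of \<open>E\<close> modulo \<open>C\<close>, and these are written in
  the same way.\<close>

definition cong :: "'u list set \<Rightarrow> 'u list set \<Rightarrow> ('u list \<times> 'u list) set" where
  "cong X C = {(x, y). x \<in> X \<and> y \<in> X \<and> x \<otimes> inv y \<in> C}"

abbreviation qdim :: "'u list set \<Rightarrow> 'u list set \<Rightarrow> nat" where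
  "qdim X C \<equiv> dim M (X // cong X C)"

abbreviation fin_index :: "'u list set \<Rightarrow> 'u list set \<Rightarrow> bool" where
  "fin_index X C \<equiv> finite (X // cong X C)"

definition dsubgroup :: "'u list set \<Rightarrow> bool" where
  "dsubgroup C \<longleftrightarrow> subgroup C A \<and> dfbl k C"

lemma dsubgroupD:
  assumes "dsubgroup C"
  shows "subgroup C A" "dfbl k C" "C \<subseteq> carrier A" "C \<subseteq> tuples k" "\<one> \<in> C"
  using assms carrier_tuples by (auto simp: dsubgroup_def subgroup.subset dest: subgroup.subset subgroup.one_closed)

lemma diff_sym:
  assumes "subgroup C A" "x \<in> carrier A" "y \<in> carrier A" "x \<otimes> inv y \<in> C"
  shows "y \<otimes> inv x \<in> C"
proof -
  have "inv (x \<otimes> inv y) = y \<otimes> inv x" using assms(2,3) by (simp add: inv_mult m_comm)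
  then show ?thesis using subgroup.m_inv_closed[OF assms(1,4)] by simp
qed

lemma diff_trans:
  assumes "subgroup C A" "x \<in> carrier A" "y \<in> carrier A" "z \<in> carrier A"
    and "x \<otimes> inv y \<in> C" "y \<otimes> inv z \<in> C"
  shows "x \<otimes> inv z \<in> C"
proof -
  have "(x \<otimes> inv y) \<otimes> (y \<otimes> inv z) = x \<otimes> inv z"
    using assms(2-4) by (simp add: m_assoc) (simp flip: m_assoc)
  then show ?thesis using subgroup.m_closed[OF assms(1,5,6)] by simp
qed

lemma diff_refl: "subgroup C A \<Longrightarrow> x \<in> carrier A \<Longrightarrow> x \<otimes> inv x \<in> C"
  by (simp add: subgroup.one_closed)

lemma equiv_cong:
  assumes C: "subgroup C A" and X: "X \<subseteq> carrier A"
  shows "equiv X (cong X C)"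
proof (rule equivI)
  show "cong X C \<subseteq> X \<times> X" by (auto simp: cong_def)
  show "refl_on X (cong X C)"
    using X diff_refl[OF C] by (auto simp: cong_def refl_on_def)
  show "sym (cong X C)"
    using X diff_sym[OF C] by (auto simp: cong_def sym_def)
  show "trans (cong X C)"
    using X diff_trans[OF C] unfolding cong_def trans_def by blast
qed

lemma dfun_pair:
  assumes "X \<subseteq> tuples m" "Y \<subseteq> tuples n"
  shows "dfun (m + n) (ext (\<lambda>y. y)) (Y \<times> X) m snd" "dfun (m + n) (ext (\<lambda>y. y)) (Y \<times> X) n fst"
proof -
  have h: "(\<lambda>y. y) \<in> Y \<rightarrow> tuples n" using assms by auto
  show "dfun (m + n) (ext (\<lambda>y. y)) (Y \<times> X) m snd" by (rule dfun_snd[OF h assms(1)])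
  show "dfun (m + n) (ext (\<lambda>y. y)) (Y \<times> X) n fst" by (rule dfun_fst[OF dfun_env[OF h] assms(1)])
qed

lemma dfbl_cong_rel:
  assumes C: "dfbl k C" and X: "dfbl k X" "X \<subseteq> carrier A"
  shows "dfbl (k + k) {x @ y | x y. (x, y) \<in> cong X C}"
proof -
  have "dfbl (k + k) {x @ y | x y. x \<in> X \<and> y \<in> X \<and> x \<otimes> inv y \<in> C}"
    by (intro dfbl_collect2 X dpred_in[OF _ C] dfun_mult dfun_inv dfun_pair dfbl_subset[OF X(1)])
       (use X(2) in auto)
  then show ?thesis by (simp add: cong_def)
qed

lemma interpretable_cong:
  assumes "dsubgroup C" "dfbl k X" "X \<subseteq> carrier A"
  shows "interpretable L M (X // cong X C)"
  using assms dsubgroupD[OF assms(1)] by (intro interpretable_quotient[of k] equiv_cong dfbl_cong_rel) auto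

lemma Restr_cong: "Z \<subseteq> X \<Longrightarrow> Restr (cong X C) Z = cong Z C"
  by (auto simp: cong_def)

lemma diff_cong:
  assumes C: "subgroup C A" and "x \<in> carrier A" "x' \<in> carrier A" "y \<in> carrier A" "y' \<in> carrier A"
    and "x \<otimes> inv x' \<in> C" "y \<otimes> inv y' \<in> C" "x \<otimes> inv y \<in> C"
  shows "x' \<otimes> inv y' \<in> C"
  using assms diff_sym[OF C, of x x'] diff_trans[OF C, of x' x y] diff_trans[OF C, of x' y y']
  by blast

lemma diff_mult_inv:
  assumes "x \<in> carrier A" "y \<in> carrier A" "z \<in> carrier A"
  shows "x \<otimes> inv y \<otimes> inv z = x \<otimes> inv (z \<otimes> y)"
  using assms by (simp add: inv_mult_group m_assoc)

text \<open>\<open>X\<close> is the coset of \<open>E\<close> through \<open>a\<close>, and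
  \<open>x \<mapsto> x \<otimes> inv a\<close> induces a surjection of X/C onto E/C;
  \<open>R\<close> is this map modulo \<open>C\<close>. The fibration inequality asks for exactly
  such a lower bound on the coset.\<close>

lemma qdim_translate:
  assumes C: "dsubgroup C" and E: "dsubgroup E" and a: "a \<in> carrier A"
    and X: "dfbl k X" "X = {x \<in> carrier A. x \<otimes> inv a \<in> E}"
  shows "qdim E C \<le> qdim X C"
proof (rule dim_bijection[where R = "\<lambda>x y. x \<otimes> inv (y \<otimes> a) \<in> C"])
  note C' = dsubgroupD[OF C] and E' = dsubgroupD[OF E]
  have XA: "X \<subseteq> carrier A" using X by auto
  have one: "a \<in> tuples k" using carrier_tuples a by auto
  show "dfbl k X" "equiv X (cong X C)" "dfbl (k + k) {x @ y |x y. (x, y) \<in> cong X C}"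
    "dfbl k E" "equiv E (cong E C)" "dfbl (k + k) {x @ y |x y. (x, y) \<in> cong E C}"
    using X(1) XA C' E' by (auto intro: equiv_cong dfbl_cong_rel)
  show "E \<noteq> {}" using E' by auto
  show "dfbl (k + k) {x @ y |x y. x \<in> X \<and> y \<in> E \<and> x \<otimes> inv (y \<otimes> a) \<in> C}"
    by (intro dfbl_collect2 X(1) E' dpred_in[OF _ C'(2)] dfun_mult dfun_inv dfun_pair dfun_const
          ext_enc one dfbl_subset[OF X(1)])
       (use XA E' a in auto)
  show "x' \<otimes> inv (y' \<otimes> a) \<in> C"
    if "x \<otimes> inv (y \<otimes> a) \<in> C" "(x, x') \<in> cong X C" "(y, y') \<in> cong E C" for x x' y y'
  proof (rule diff_cong[OF C'(1), of x _ "y \<otimes> a"])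
    have "y \<in> carrier A" "y' \<in> carrier A" using that E' by (auto simp: cong_def)
    then have "(y \<otimes> a) \<otimes> inv (y' \<otimes> a) = y \<otimes> inv y'"
      using a by (simp add: m_comm[of _ a] inv_mult_group m_assoc) (simp add: m_comm[of _ "inv a"] flip: m_assoc)
    then show "(y \<otimes> a) \<otimes> inv (y' \<otimes> a) \<in> C" using that by (simp add: cong_def)
  qed (use that XA E' a in \<open>auto simp: cong_def\<close>)
  show "\<exists>y\<in>E. x \<otimes> inv (y \<otimes> a) \<in> C" if "x \<in> X" for x
  proof (rule bexI)
    show "x \<otimes> inv a \<in> E" using that X by auto
    have "x \<otimes> inv a \<otimes> a = x" using that XA a by (simp add: m_assoc subset_iff)
    then show "x \<otimes> inv (x \<otimes> inv a \<otimes> a) \<in> C" using that XA C' by auto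
  qed
  show "\<exists>x\<in>X. x \<otimes> inv (y \<otimes> a) \<in> C" if "y \<in> E" for y
  proof (rule bexI)
    have "y \<otimes> a \<otimes> inv a = y" using that E' a by (simp add: m_assoc subset_iff)
    then show "y \<otimes> a \<in> X" using that X E' a by auto
    show "(y \<otimes> a) \<otimes> inv (y \<otimes> a) \<in> C" using that E' a C' by auto
  qed
  show "(y, y') \<in> cong E C" if "x \<in> X" "y \<in> E" "y' \<in> E" "x \<otimes> inv (y \<otimes> a) \<in> C" "x \<otimes> inv (y' \<otimes> a) \<in> C"
    for x y y'
  proof -
    have A: "x \<in> carrier A" "y \<in> carrier A" "y' \<in> carrier A" using that XA E' by auto
    then have "(y \<otimes> a) \<otimes> inv (y' \<otimes> a) \<in> C"
      using that diff_sym[OF C'(1), of x "y \<otimes> a"] diff_trans[OF C'(1), of "y \<otimes> a" x "y' \<otimes> a"] a by auto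
    moreover have "(y \<otimes> a) \<otimes> inv (y' \<otimes> a) = y \<otimes> inv y'"
      using A a by (simp add: m_comm[of _ a] inv_mult_group m_assoc) (simp add: m_comm[of _ "inv a"] flip: m_assoc)
    ultimately show ?thesis using that by (simp add: cong_def)
  qed
qed

lemma dfbl_coset:
  assumes B: "dfbl k B" "B \<subseteq> carrier A" and E: "dfbl k E" and a: "a \<in> carrier A"
  shows "dfbl k {x \<in> B. x \<otimes> inv a \<in> E}"
  using a carrier_tuples B
  by (intro dfbl_collect B dpred_in[OF _ E] dfun_mult dfun_inv dfun_const dfun_env) auto

text \<open>Fibration along B/C \<rightarrow> B/E, whose fibres are cosets of \<open>E\<close>
  modulo \<open>C\<close>, each of dimension at least that of E/C by translation.\<close>

lemma qdim_tower:
  assumes C: "dsubgroup C" and E: "dsubgroup E" and B: "dsubgroup B"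
    and CE: "C \<subseteq> E" and EB: "E \<subseteq> B"
  shows "qdim B E + qdim E C \<le> qdim B C"
proof (rule dim_fibration[where R = "\<lambda>x y. x \<otimes> inv y \<in> E"])
  note C' = dsubgroupD[OF C] and E' = dsubgroupD[OF E] and B' = dsubgroupD[OF B]
  show "dfbl k B" "equiv B (cong B C)" "dfbl (k + k) {x @ y |x y. (x, y) \<in> cong B C}"
    "dfbl k B" "equiv B (cong B E)" "dfbl (k + k) {x @ y |x y. (x, y) \<in> cong B E}"
    using C' E' B' by (auto intro: equiv_cong dfbl_cong_rel)
  then show "dfbl (k + k) {x @ y |x y. x \<in> B \<and> y \<in> B \<and> x \<otimes> inv y \<in> E}"
    by (simp add: cong_def)
  show "B \<noteq> {}" using B' by auto
  show "x' \<otimes> inv y' \<in> E"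
    if "x \<otimes> inv y \<in> E" "(x, x') \<in> cong B C" "(y, y') \<in> cong B E" for x x' y y'
    by (rule diff_cong[OF E'(1), of x _ y]) (use that CE B' in \<open>auto simp: cong_def\<close>)
  show "\<exists>y\<in>B. x \<otimes> inv y \<in> E" "\<exists>y\<in>B. y \<otimes> inv x \<in> E" if "x \<in> B" for x
    using diff_refl[OF E'(1)] B' that by blast+
  show "(y, y') \<in> cong B E" if "x \<in> B" "y \<in> B" "y' \<in> B" "x \<otimes> inv y \<in> E" "x \<otimes> inv y' \<in> E" for x y y'
    using that diff_sym[OF E'(1), of x y] diff_trans[OF E'(1), of y x y'] B' by (auto simp: cong_def)
  fix a
  assume a: "a \<in> B"
  \<comment> \<open>As \<open>E \<subseteq> B\<close>, the fibre over \<open>a\<close> is a full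
    coset of \<open>E\<close> in \<open>A\<close>, the form expected by
    \<open>qdim_translate\<close>.\<close>
  have "x \<in> B" if "x \<in> carrier A" "x \<otimes> inv a \<in> E" for x
  proof -
    have "x \<otimes> inv a \<otimes> a \<in> B" using that a EB subgroup.m_closed[OF B'(1)] by blast
    then show ?thesis using that a B' by (simp add: m_assoc subset_iff)
  qed
  then have "{x \<in> B. x \<otimes> inv a \<in> E} = {x \<in> carrier A. x \<otimes> inv a \<in> E}" using B' by auto
  then have "qdim E C \<le> qdim {x \<in> B. x \<otimes> inv a \<in> E} C"
    using C E a B' E' by (intro qdim_translate dfbl_coset) auto
  then show "qdim E C \<le> dim M ({x \<in> B. x \<otimes> inv a \<in> E} // Restr (cong B C) {x \<in> B. x \<otimes> inv a \<in> E})"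
    by (subst Restr_cong) auto
qed

text \<open>Additively the set is B \<inter> (\<phi>(B) + C): the elements of \<open>B\<close> that
  lie in the image of \<open>\<phi>\<close> modulo \<open>C\<close>.\<close>

lemma dsubgroup_image_mult:
  assumes B: "dsubgroup B" and C: "dsubgroup C" and "\<phi> ` B \<subseteq> B"
    and \<phi>: "\<And>x y. x \<in> B \<Longrightarrow> y \<in> B \<Longrightarrow> \<phi> (x \<otimes> y) = \<phi> x \<otimes> \<phi> y"
    and def: "dfun k (\<lambda>x. x) B k \<phi>"
  shows "dsubgroup {x \<in> B. \<exists>b\<in>B. x \<otimes> inv (\<phi> b) \<in> C}"
proof -
  note C' = dsubgroupD[OF C] and B' = dsubgroupD[OF B]
  have BA: "b \<in> carrier A" if "b \<in> B" for b using that B' by auto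
  have \<phi>B: "\<phi> b \<in> B" if "b \<in> B" for b using that assms by auto
  have "dfbl k {x \<in> B. \<exists>b\<in>B. x \<otimes> inv (\<phi> b) \<in> C}"
  proof (intro dfbl_collect[OF B'(2)] dpred_ex[OF B'(2)] dpred_in[OF _ C'(2)])
    show id: "(\<lambda>x. x) \<in> B \<rightarrow> tuples k" using B' by auto
    have "dfun (k + k) (ext (\<lambda>x. x)) (B \<times> B) k (\<lambda>p. \<phi> (snd p))"
      by (rule dfun_comp[OF def B'(2) dfun_pair(1)[OF B'(4,4)]]) auto
    then show "dfun (k + k) (ext (\<lambda>x. x)) (B \<times> B) k (\<lambda>p. fst p \<otimes> inv (\<phi> (snd p)))"
      using BA \<phi>B B' by (intro dfun_mult dfun_pair dfun_inv) auto
  qed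
  moreover have "subgroup {x \<in> B. \<exists>b\<in>B. x \<otimes> inv (\<phi> b) \<in> C} A"
  proof (rule subgroupI)
    have \<phi>A: "\<phi> b \<in> carrier A" if "b \<in> B" for b using that \<phi>B BA by blast
    have \<phi>1: "\<phi> \<one> = \<one>"
      using \<phi>[of \<one> \<one>] B'(5) \<phi>A l_cancel_one' by fastforce
    show "{x \<in> B. \<exists>b\<in>B. x \<otimes> inv (\<phi> b) \<in> C} \<subseteq> carrier A" using BA by auto
    show "{x \<in> B. \<exists>b\<in>B. x \<otimes> inv (\<phi> b) \<in> C} \<noteq> {}"
      using \<phi>1 B'(5) C'(5) by force
    fix x
    assume "x \<in> {x \<in> B. \<exists>b\<in>B. x \<otimes> inv (\<phi> b) \<in> C}"
    then obtain b where x: "x \<in> B" "b \<in> B" "x \<otimes> inv (\<phi> b) \<in> C" by blast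
    have b': "inv b \<in> B" using x B' by (simp add: subgroup.m_inv_closed)
    have "\<phi> (inv b) \<otimes> \<phi> b = \<one>" using \<phi>[OF b' x(2)] \<phi>1 BA x by simp
    then have "\<phi> (inv b) = inv (\<phi> b)" using inv_equality \<phi>A x(2) b' by metis
    then have "inv x \<otimes> inv (\<phi> (inv b)) = inv (x \<otimes> inv (\<phi> b))"
      using x BA \<phi>A by (simp add: inv_mult)
    then have "inv x \<otimes> inv (\<phi> (inv b)) \<in> C" using subgroup.m_inv_closed[OF C'(1) x(3)] by simp
    then show "inv x \<in> {x \<in> B. \<exists>b\<in>B. x \<otimes> inv (\<phi> b) \<in> C}"
      using b' x B' by (auto simp: subgroup.m_inv_closed)
    fix y
    assume "y \<in> {x \<in> B. \<exists>b\<in>B. x \<otimes> inv (\<phi> b) \<in> C}"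
    then obtain c where y: "y \<in> B" "c \<in> B" "y \<otimes> inv (\<phi> c) \<in> C" by blast
    have "(x \<otimes> y) \<otimes> inv (\<phi> (b \<otimes> c)) = (x \<otimes> inv (\<phi> b)) \<otimes> (y \<otimes> inv (\<phi> c))"
      using x y BA \<phi>A by (simp add: \<phi> inv_mult m_ac)
    then have "(x \<otimes> y) \<otimes> inv (\<phi> (b \<otimes> c)) \<in> C"
      using subgroup.m_closed[OF C'(1) x(3) y(3)] by simp
    then show "x \<otimes> y \<in> {x \<in> B. \<exists>b\<in>B. x \<otimes> inv (\<phi> b) \<in> C}"
      using x y B' by (auto simp: subgroup.m_closed)
  qed
  ultimately show ?thesis by (simp add: dsubgroup_def)
qed

text \<open>An endomorphism of \<open>B\<close> that is injective modulo \<open>C\<close> maps \<open>B/C\<close> onto a quotient \<open>E/C\<close> of the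
  same dimension, so that no dimension is left for \<open>B/E\<close>.\<close>

lemma fin_index_image_mult:
  assumes B: "dsubgroup B" and C: "dsubgroup C" and CB: "C \<subseteq> B" and \<phi>B: "\<phi> ` B \<subseteq> B"
    and \<phi>: "\<And>x y. x \<in> B \<Longrightarrow> y \<in> B \<Longrightarrow> \<phi> (x \<otimes> y) = \<phi> x \<otimes> \<phi> y"
    and def: "dfun k (\<lambda>x. x) B k \<phi>"
    and ker: "\<And>x. x \<in> B \<Longrightarrow> \<phi> x \<in> C \<longleftrightarrow> x \<in> C"
  shows "fin_index B {x \<in> B. \<exists>b\<in>B. x \<otimes> inv (\<phi> b) \<in> C}" (is "fin_index B ?E")
proof -
  have E: "dsubgroup ?E" using B C \<phi>B \<phi> def by (rule dsubgroup_image_mult)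
  note C' = dsubgroupD[OF C] and B' = dsubgroupD[OF B] and E' = dsubgroupD[OF E]
  have BA: "b \<in> carrier A" if "b \<in> B" for b using that B' by auto
  have \<phi>A: "\<phi> b \<in> carrier A" if "b \<in> B" for b using that \<phi>B BA by auto
  have \<phi>1: "\<phi> \<one> = \<one>"
    using \<phi>[of \<one> \<one>] B'(5) \<phi>A l_cancel_one' by fastforce
  have \<phi>_diff: "\<phi> x \<otimes> inv (\<phi> y) = \<phi> (x \<otimes> inv y)" if "x \<in> B" "y \<in> B" for x y
  proof -
    have y': "inv y \<in> B" using that B' by (simp add: subgroup.m_inv_closed)
    have "\<phi> (inv y) \<otimes> \<phi> y = \<one>" using \<phi>[OF y' that(2)] \<phi>1 BA that by simp
    then have "\<phi> (inv y) = inv (\<phi> y)" using inv_equality \<phi>A that(2) y' by metis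
    then show ?thesis using \<phi>[OF that(1) y'] by simp
  qed
  have diff_B: "x \<otimes> inv y \<in> B" if "x \<in> B" "y \<in> B" for x y
    using that B' by (simp add: subgroup.m_inv_closed subgroup.m_closed)
  have ker_diff: "\<phi> x \<otimes> inv (\<phi> y) \<in> C \<longleftrightarrow> x \<otimes> inv y \<in> C" if "x \<in> B" "y \<in> B" for x y
    using \<phi>_diff[OF that] ker[OF diff_B[OF that]] by simp
  have CE: "C \<subseteq> ?E"
  proof
    fix x
    assume "x \<in> C"
    then have "x \<otimes> inv (\<phi> \<one>) \<in> C" using C' \<phi>1 by auto
    then show "x \<in> ?E" using CB B' \<open>x \<in> C\<close> by blast
  qed
  \<comment> \<open>The surjection is the inverse of \<open>\<phi>\<close> modulo \<open>C\<close>,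
    from the quotient of \<open>?E\<close> to that of \<open>B\<close>: \<open>R x y\<close> says
    that \<open>x\<close> is congruent to \<open>\<phi> y\<close>, and injectivity modulo
    \<open>C\<close> makes \<open>y\<close> unique up to \<open>C\<close>.\<close>
  have "qdim B C \<le> qdim ?E C"
  proof (rule dim_bijection[where R = "\<lambda>x y. x \<otimes> inv (\<phi> y) \<in> C"])
    show "dfbl k ?E" "equiv ?E (cong ?E C)" "dfbl (k + k) {x @ y |x y. (x, y) \<in> cong ?E C}"
      "dfbl k B" "equiv B (cong B C)" "dfbl (k + k) {x @ y |x y. (x, y) \<in> cong B C}"
      using E' C' B' by (auto intro: equiv_cong dfbl_cong_rel)
    show "B \<noteq> {}" using B' by auto
    show "dfbl (k + k) {x @ y |x y. x \<in> ?E \<and> y \<in> B \<and> x \<otimes> inv (\<phi> y) \<in> C}"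
      by (intro dfbl_collect2 E' B' dpred_in[OF _ C'(2)] dfun_mult dfun_inv dfun_pair
            dfun_comp[OF def B'(2)])
         (use BA \<phi>A in auto)
    show "x' \<otimes> inv (\<phi> y') \<in> C"
      if "x \<otimes> inv (\<phi> y) \<in> C" "(x, x') \<in> cong ?E C" "(y, y') \<in> cong B C" for x x' y y'
      by (rule diff_cong[OF C'(1), of x _ "\<phi> y"])
         (use that BA \<phi>A ker_diff in \<open>auto simp: cong_def\<close>)
    show "\<exists>y\<in>B. x \<otimes> inv (\<phi> y) \<in> C" if "x \<in> ?E" for x
      using that by auto
    show "\<exists>x\<in>?E. x \<otimes> inv (\<phi> y) \<in> C" if "y \<in> B" for y
      using that \<phi>B diff_refl[OF C'(1) \<phi>A[OF that]] by blast
    show "(y, y') \<in> cong B C"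
      if "x \<in> ?E" "y \<in> B" "y' \<in> B" "x \<otimes> inv (\<phi> y) \<in> C" "x \<otimes> inv (\<phi> y') \<in> C" for x y y'
    proof -
      have "\<phi> y \<otimes> inv (\<phi> y') \<in> C"
        using diff_sym[OF C'(1), of x "\<phi> y"] diff_trans[OF C'(1), of "\<phi> y" x "\<phi> y'"] that BA \<phi>A
        by auto
      then show ?thesis using that ker_diff by (simp add: cong_def)
    qed
  qed
  moreover have "qdim B ?E + qdim ?E C \<le> qdim B C"
    using C E B CE by (rule qdim_tower) auto
  ultimately have "qdim B ?E = 0" by simp
  then show ?thesis
    using dim_eq_0 interpretable_cong[OF E B'(2,3)] by simp
qed

section \<open>Finite index and connected definable subgroups\<close>

text \<open>Links right cosets, in which \<open>definable_finite_index\<close> is stated, with the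
  classes of \<open>cong\<close>, for which a dimension is available.\<close>

lemma rcosets_eq_quotient:
  assumes C: "subgroup C A" and B: "B \<subseteq> carrier A" and CB: "\<And>x c. x \<in> B \<Longrightarrow> c \<in> C \<Longrightarrow> c \<otimes> x \<in> B"
  shows "rcosets\<^bsub>A\<lparr>carrier := B\<rparr>\<^esub> C = B // cong B C"
proof -
  have "C #> b = cong B C `` {b}" if b: "b \<in> B" for b
  proof
    show "C #> b \<subseteq> cong B C `` {b}"
    proof
      fix x
      assume "x \<in> C #> b"
      then obtain c where c: "c \<in> C" "x = c \<otimes> b" by (auto simp: r_coset_def)
      have "b \<in> carrier A" "c \<in> carrier A" using b B c subgroup.subset[OF C] by auto
      moreover from this have "x \<otimes> inv b = c" by (simp add: c m_assoc)
      ultimately have "b \<otimes> inv x \<in> C" using c diff_sym[OF C, of x b] by auto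
      then show "x \<in> cong B C `` {b}" using CB b c by (auto simp: cong_def)
    qed
    show "cong B C `` {b} \<subseteq> C #> b"
    proof
      fix x
      assume "x \<in> cong B C `` {b}"
      then have x: "x \<in> B" "b \<otimes> inv x \<in> C" by (auto simp: cong_def)
      have A: "b \<in> carrier A" "x \<in> carrier A" using b x B by auto
      then have "x \<otimes> inv b \<in> C" using diff_sym[OF C] x by blast
      moreover have "x = (x \<otimes> inv b) \<otimes> b" using A by (simp add: m_assoc)
      ultimately show "x \<in> C #> b" by (auto simp: r_coset_def)
    qed
  qed
  then show ?thesis by (auto simp: RCOSETS_def quotient_def r_coset_def)
qed

text \<open>This is connectedness of the group \<open>A\<lparr>carrier := B\<rparr>\<close>,
  restated for subgroups of \<open>A\<close> so that finite index is read off from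
  \<open>cong\<close>.\<close>

definition conn :: "'u list set \<Rightarrow> bool" where
  "conn B \<longleftrightarrow> (\<forall>H. dsubgroup H \<and> H \<subseteq> B \<and> fin_index B H \<longrightarrow> H = B)"

lemma definable_finite_index_iff:
  assumes B: "dsubgroup B"
  shows "definable_finite_index L M (A\<lparr>carrier := B\<rparr>) H \<longleftrightarrow> dsubgroup H \<and> H \<subseteq> B \<and> fin_index B H"
proof -
  note B' = dsubgroupD[OF B]
  have "subgroup H (A\<lparr>carrier := B\<rparr>) \<longleftrightarrow> subgroup H A \<and> H \<subseteq> B"
    using incl_subgroup[OF B'(1)] subgroup_incl[OF _ B'(1)] subgroup.subset by fastforce
  moreover have "definable L M H \<longleftrightarrow> dfbl k H" if "subgroup H A"
    using that definable_dfbl dfbl_definable carrier_tuples subgroup.subset[OF that] subgroup.one_closed[OF that]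
    by blast
  moreover have "rcosets\<^bsub>A\<lparr>carrier := B\<rparr>\<^esub> H = B // cong B H" if "subgroup H A" "H \<subseteq> B"
    by (rule rcosets_eq_quotient) (use that B' subgroup.m_closed[OF B'(1)] in auto)
  ultimately show ?thesis
    by (auto simp: definable_finite_index_def dsubgroup_def)
qed

text \<open>Connected components are assumed for definable groups; viewing a definable subgroup of
  \<open>A\<close> as a group of its own gives it a component as well.\<close>

lemma definable_group_subgroup:
  assumes B: "dsubgroup B"
  shows "definable_group L M (A\<lparr>carrier := B\<rparr>)"
proof -
  note B' = dsubgroupD[OF B]
  let ?Gr = "{x @ y @ (x \<otimes> y) | x y. x \<in> carrier A \<and> y \<in> carrier A}"
  \<comment> \<open>The repeated conjunct fills the predicate slot \<open>P\<close> of
    \<open>dfbl_collect2\<close>.\<close>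
  let ?BB = "{y @ z | y z. y \<in> B \<and> z \<in> B \<and> z \<in> B}"
  have id: "(\<lambda>y. y) \<in> X \<rightarrow> tuples n" if "X \<subseteq> tuples n" for X n using that by auto
  have BB: "dfbl (k + k) ?BB"
    by (intro dfbl_collect2 B' dpred_in[OF dfun_pair(2)[OF B'(4,4)] B'(2)])
  have "dfbl (k + (k + k)) {x @ w | x w. x \<in> B \<and> w \<in> ?BB \<and> x @ w \<in> ?Gr}"
    by (intro dfbl_collect2 B' BB dpred_sel[OF dfbl_mult] dsel_append dsel_snd dsel_fst[OF dsel_env]
          id[OF dfbl_subset[OF BB]])
  moreover have "{x @ w | x w. x \<in> B \<and> w \<in> ?BB \<and> x @ w \<in> ?Gr} =
      {x @ y @ (x \<otimes> y) | x y. x \<in> B \<and> y \<in> B}"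
  proof (intro Set.set_eqI iffI)
    fix v
    assume "v \<in> {x @ w | x w. x \<in> B \<and> w \<in> ?BB \<and> x @ w \<in> ?Gr}"
    then obtain x w where w: "v = x @ w" "x \<in> B" "w \<in> ?BB" "v \<in> ?Gr" by blast
    then obtain y z where "w = y @ z" "y \<in> B" by blast
    with w have v: "v = x @ y @ z" "x \<in> B" "y \<in> B" "v \<in> ?Gr" by simp_all
    from v(4) obtain x' y' where v': "v = x' @ y' @ (x' \<otimes> y')" "x' \<in> carrier A" "y' \<in> carrier A" by blast
    have "length x = k" "length y = k" "length x' = k" "length y' = k"
      using v v' B' carrier_tuples by (auto simp: tuples_def subset_iff)
    then have "z = x \<otimes> y" using v(1) v'(1) by auto
    then show "v \<in> {x @ y @ (x \<otimes> y) | x y. x \<in> B \<and> y \<in> B}" using v by blast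
  next
    fix v
    assume "v \<in> {x @ y @ (x \<otimes> y) | x y. x \<in> B \<and> y \<in> B}"
    then obtain x y where v: "v = x @ y @ (x \<otimes> y)" "x \<in> B" "y \<in> B" by blast
    then have "x \<otimes> y \<in> B" using B' by (simp add: subgroup.m_closed)
    then have 1: "y @ (x \<otimes> y) \<in> ?BB" using v by blast
    have 2: "x @ y @ (x \<otimes> y) \<in> ?Gr"
      by (rule CollectI, rule exI[of _ x], rule exI[of _ y]) (use v B'(3) in auto)
    show "v \<in> {x @ w | x w. x \<in> B \<and> w \<in> ?BB \<and> x @ w \<in> ?Gr}"
      unfolding v(1)
      by (rule CollectI, rule exI[of _ x], rule exI[of _ "y @ (x \<otimes> y)"])
         (rule conjI[OF HOL.refl conjI[OF v(2) conjI[OF 1 2]]])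
  qed
  ultimately have "dfbl (k + (k + k)) {x @ y @ (x \<otimes> y) | x y. x \<in> B \<and> y \<in> B}"
    by simp
  then show ?thesis
    using B' by (auto simp: definable_group_def intro: subgroup_imp_group dfbl_definable)
qed

text \<open>Unlike classes, representatives can be multiplied, which is how finite index is shown to
  be transitive.\<close>

lemma fin_index_iff:
  assumes C: "subgroup C A" and X: "X \<subseteq> carrier A"
  shows "fin_index X C \<longleftrightarrow> (\<exists>R. finite R \<and> R \<subseteq> X \<and> (\<forall>x\<in>X. \<exists>r\<in>R. x \<otimes> inv r \<in> C))"
proof
  assume fin: "fin_index X C"
  define rep where "rep Q = (SOME x. x \<in> Q)" for Q :: "'u list set"
  have rep: "rep (cong X C `` {x}) \<in> cong X C `` {x}" if "x \<in> X" for x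
    using equiv_class_self[OF equiv_cong[OF C X] that] unfolding rep_def by (rule someI)
  have "x \<otimes> inv (rep (cong X C `` {x})) \<in> C \<and> rep (cong X C `` {x}) \<in> X" if "x \<in> X" for x
    using rep[OF that] unfolding cong_def by blast
  then show "\<exists>R. finite R \<and> R \<subseteq> X \<and> (\<forall>x\<in>X. \<exists>r\<in>R. x \<otimes> inv r \<in> C)"
    using fin by (intro exI[of _ "rep ` (X // cong X C)"]) (auto elim!: quotientE intro: quotientI)
next
  assume "\<exists>R. finite R \<and> R \<subseteq> X \<and> (\<forall>x\<in>X. \<exists>r\<in>R. x \<otimes> inv r \<in> C)"
  then obtain R where R: "finite R" "R \<subseteq> X" "\<forall>x\<in>X. \<exists>r\<in>R. x \<otimes> inv r \<in> C" by blast
  have "X // cong X C \<subseteq> (\<lambda>r. cong X C `` {r}) ` R"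
  proof
    fix Q
    assume "Q \<in> X // cong X C"
    then obtain x where x: "x \<in> X" "Q = cong X C `` {x}" by (rule quotientE)
    then obtain r where r: "r \<in> R" "x \<otimes> inv r \<in> C" using R by blast
    then have "(x, r) \<in> cong X C" using x R by (auto simp: cong_def)
    then have "Q = cong X C `` {r}" using x equiv_class_eq[OF equiv_cong[OF C X]] by simp
    then show "Q \<in> (\<lambda>r. cong X C `` {r}) ` R" using r by blast
  qed
  then show "fin_index X C" by (rule finite_surj[OF R(1)])
qed

lemma fin_index_trans:
  assumes C: "subgroup C A" and E: "subgroup E A" and X: "X \<subseteq> carrier A"
    and "C \<subseteq> E" "E \<subseteq> X" and mult: "\<And>x y. x \<in> E \<Longrightarrow> y \<in> X \<Longrightarrow> x \<otimes> y \<in> X"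
    and "fin_index X E" "fin_index E C"
  shows "fin_index X C"
proof -
  have EA: "E \<subseteq> carrier A" using E by (rule subgroup.subset)
  obtain R where R: "finite R" "R \<subseteq> X" "\<forall>x\<in>X. \<exists>r\<in>R. x \<otimes> inv r \<in> E"
    using fin_index_iff[OF E X] assms(7) by blast
  obtain Q where Q: "finite Q" "Q \<subseteq> E" "\<forall>x\<in>E. \<exists>q\<in>Q. x \<otimes> inv q \<in> C"
    using fin_index_iff[OF C EA] assms(8) by blast
  \<comment> \<open>Representatives of \<open>X\<close> modulo \<open>C\<close> are products of
    those of \<open>E\<close> modulo \<open>C\<close> with those of \<open>X\<close> modulo
    \<open>E\<close>.\<close>
  have "\<exists>s\<in>(\<lambda>(q, r). q \<otimes> r) ` (Q \<times> R). x \<otimes> inv s \<in> C" if x: "x \<in> X" for x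
  proof -
    obtain r where r: "r \<in> R" "x \<otimes> inv r \<in> E" using R x by blast
    then obtain q where q: "q \<in> Q" "x \<otimes> inv r \<otimes> inv q \<in> C" using Q by blast
    have "x \<otimes> inv (q \<otimes> r) \<in> C"
      using q diff_mult_inv[of x r q] x r R Q X EA by (metis subsetD)
    then show ?thesis using q r by force
  qed
  moreover have "(\<lambda>(q, r). q \<otimes> r) ` (Q \<times> R) \<subseteq> X"
  proof
    fix s
    assume "s \<in> (\<lambda>(q, r). q \<otimes> r) ` (Q \<times> R)"
    then obtain q r where "s = q \<otimes> r" "q \<in> Q" "r \<in> R" by auto
    then show "s \<in> X" using Q(2) R(2) mult[of q r] by auto
  qed
  moreover have "finite ((\<lambda>(q, r). q \<otimes> r) ` (Q \<times> R))" using Q(1) R(1) by simp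
  ultimately show ?thesis unfolding fin_index_iff[OF C X] by (intro exI conjI ballI)
qed

text \<open>Each class on \<open>Y\<close> is the trace of a class on \<open>X\<close>.\<close>

lemma fin_index_subset:
  assumes "fin_index X C" "Y \<subseteq> X"
  shows "fin_index Y C"
proof -
  have "Y // cong Y C \<subseteq> (\<lambda>Q. Q \<inter> Y) ` (X // cong X C)"
  proof
    fix Q
    assume "Q \<in> Y // cong Y C"
    then obtain y where y: "y \<in> Y" "Q = cong Y C `` {y}" by (rule quotientE)
    then have "Q = cong X C `` {y} \<inter> Y" using assms(2) by (auto simp: cong_def)
    moreover have "cong X C `` {y} \<in> X // cong X C" using y assms(2) by (blast intro: quotientI)
    ultimately show "Q \<in> (\<lambda>Q. Q \<inter> Y) ` (X // cong X C)" by (rule image_eqI)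
  qed
  then show ?thesis by (rule finite_surj[OF assms(1)])
qed

text \<open>Serves for three kinds of preimages: under the action of one element, under an inclusion
  (an intersection of subgroups), and under \<open>\<delta> g\<close> (the elements fixed by
  \<open>g\<close> modulo \<open>C\<close>).\<close>

lemma dsubgroup_vimage:
  assumes B: "dsubgroup B" and C: "dsubgroup C" and \<phi>A: "\<phi> ` B \<subseteq> carrier A"
    and \<phi>: "\<And>x y. x \<in> B \<Longrightarrow> y \<in> B \<Longrightarrow> \<phi> (x \<otimes> y) = \<phi> x \<otimes> \<phi> y"
    and def: "dfun k (\<lambda>x. x) B k \<phi>"
  shows "dsubgroup {x \<in> B. \<phi> x \<in> C}"
proof -
  note C' = dsubgroupD[OF C] and B' = dsubgroupD[OF B]
  have \<phi>A: "\<phi> b \<in> carrier A" if "b \<in> B" for b using that \<phi>A by blast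
  have BA: "b \<in> carrier A" if "b \<in> B" for b using that B' by auto
  have \<phi>1: "\<phi> \<one> = \<one>"
    using \<phi>[of \<one> \<one>] B'(5) \<phi>A l_cancel_one' by fastforce
  have "dfbl k {x \<in> B. \<phi> x \<in> C}"
    by (intro dfbl_collect[OF B'(2)] dpred_in[OF def C'(2)])
  moreover have "subgroup {x \<in> B. \<phi> x \<in> C} A"
  proof (rule subgroupI)
    show "{x \<in> B. \<phi> x \<in> C} \<subseteq> carrier A" using BA by auto
    show "{x \<in> B. \<phi> x \<in> C} \<noteq> {}" using \<phi>1 B'(5) C'(5) by auto
    fix x
    assume "x \<in> {x \<in> B. \<phi> x \<in> C}"
    then have x: "x \<in> B" "\<phi> x \<in> C" by auto
    have x': "inv x \<in> B" using x B' by (simp add: subgroup.m_inv_closed)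
    have "\<phi> (inv x) \<otimes> \<phi> x = \<one>" using \<phi>[OF x' x(1)] \<phi>1 BA x by simp
    then have "\<phi> (inv x) = inv (\<phi> x)" using inv_equality \<phi>A x(1) x' by metis
    then show "inv x \<in> {x \<in> B. \<phi> x \<in> C}"
      using x x' C' by (simp add: subgroup.m_inv_closed)
    fix y
    assume "y \<in> {x \<in> B. \<phi> x \<in> C}"
    then show "x \<otimes> y \<in> {x \<in> B. \<phi> x \<in> C}"
      using x \<phi> B' C' by (auto simp: subgroup.m_closed)
  qed
  ultimately show ?thesis by (simp add: dsubgroup_def)
qed

lemma dsubgroup_one: "dsubgroup {\<one>}"
proof -
  have "\<one> \<in> tuples k" using carrier_tuples by auto
  then show ?thesis using triv_subgroup by (simp add: dsubgroup_def dfbl_singleton)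
qed

lemma dsubgroup_carrier: "dsubgroup (carrier A)"
  using dfbl_carrier subgroup_self by (simp add: dsubgroup_def)

end

section \<open>Cocycles\<close>

locale group_module = A: comm_group A + G: group G
  for A :: "'a monoid" (structure) and G :: "('g, 'b) monoid_scheme" +
  fixes act :: "'g \<Rightarrow> 'a \<Rightarrow> 'a"
  assumes act_hom: "act \<in> hom G (AutoGroup A)"
begin

lemma act_auto: "g \<in> carrier G \<Longrightarrow> act g \<in> auto A"
  using act_hom by (auto simp: hom_def AutoGroup_def)

lemma act_closed [simp]: "g \<in> carrier G \<Longrightarrow> a \<in> carrier A \<Longrightarrow> act g a \<in> carrier A"
  using act_auto[of g] by (auto simp: auto_def hom_def)

lemma act_mult: "g \<in> carrier G \<Longrightarrow> a \<in> carrier A \<Longrightarrow> b \<in> carrier A \<Longrightarrow> act g (a \<otimes> b) = act g a \<otimes> act g b"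
  using act_auto[of g] by (auto simp: auto_def hom_def)

lemma act_act:
  assumes "g \<in> carrier G" "h \<in> carrier G" "a \<in> carrier A"
  shows "act (g \<otimes>\<^bsub>G\<^esub> h) a = act g (act h a)"
proof -
  have "act (g \<otimes>\<^bsub>G\<^esub> h) = compose (carrier A) (act g) (act h)"
    using act_hom act_auto[OF assms(1)] act_auto[OF assms(2)] assms
    by (auto simp: hom_def AutoGroup_def BijGroup_def auto_def)
  then show ?thesis using assms by (simp add: compose_def)
qed

lemma act_one [simp]:
  assumes "a \<in> carrier A"
  shows "act \<one>\<^bsub>G\<^esub> a = a"
proof -
  have "group (AutoGroup A)" by (rule A.AutoGroup)
  then have "act \<one>\<^bsub>G\<^esub> = \<one>\<^bsub>AutoGroup A\<^esub>"
    using act_hom by (simp add: group_hom.hom_one group_hom_def group_hom_axioms_def)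
  then show ?thesis using assms by (simp add: AutoGroup_def BijGroup_def)
qed

lemma act_zero [simp]: "g \<in> carrier G \<Longrightarrow> act g \<one> = \<one>"
  using act_mult[of g \<one> \<one>] A.l_cancel_one' by fastforce

lemma act_neg: "g \<in> carrier G \<Longrightarrow> a \<in> carrier A \<Longrightarrow> act g (inv a) = inv (act g a)"
  using act_mult[of g "inv a" a] by (intro A.inv_equality[symmetric]) auto

text \<open>In operator notation this is (g - 1)a. For fixed \<open>a\<close> it is the inner
  derivation given by \<open>a\<close>, for fixed \<open>g\<close> an endomorphism of
  \<open>A\<close>; both roles are used.\<close>

definition \<delta> :: "'g \<Rightarrow> 'a \<Rightarrow> 'a" where
  "\<delta> g a = act g a \<otimes> inv a"

definition submod :: "'a set \<Rightarrow> bool" where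
  "submod B \<longleftrightarrow> subgroup B A \<and> (\<forall>g\<in>carrier G. \<forall>b\<in>B. act g b \<in> B)"

text \<open>A derivation with values in \<open>B\<close>, free outside \<open>carrier G\<close>, in
  contrast to the extensional members of \<open>Der\<close>; subtracting inner derivations then
  needs no restriction of domains.\<close>

definition cocycle :: "'a set \<Rightarrow> ('g \<Rightarrow> 'a) \<Rightarrow> bool" where
  "cocycle B f \<longleftrightarrow> (\<forall>x\<in>carrier G. f x \<in> B) \<and>
     (\<forall>x\<in>carrier G. \<forall>y\<in>carrier G. f (x \<otimes>\<^bsub>G\<^esub> y) = act x (f y) \<otimes> f x)"

text \<open>Membership in \<open>A\<close> is built in, so that chains of congruences carry their
  side conditions along.\<close>

definition eqv :: "'a set \<Rightarrow> 'a \<Rightarrow> 'a \<Rightarrow> bool" where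
  "eqv C x y \<longleftrightarrow> x \<in> carrier A \<and> y \<in> carrier A \<and> x \<otimes> inv y \<in> C"

lemma submodD:
  assumes "submod B"
  shows "subgroup B A" "B \<subseteq> carrier A" "\<one> \<in> B" "\<And>a b. a \<in> B \<Longrightarrow> b \<in> B \<Longrightarrow> a \<otimes> b \<in> B"
    "\<And>a. a \<in> B \<Longrightarrow> inv a \<in> B" "\<And>g b. g \<in> carrier G \<Longrightarrow> b \<in> B \<Longrightarrow> act g b \<in> B"
  using assms by (auto simp: submod_def subgroup.m_closed subgroup.m_inv_closed subgroup.one_closed dest: subgroup.subset)

lemma \<delta>_closed [simp]: "g \<in> carrier G \<Longrightarrow> a \<in> carrier A \<Longrightarrow> \<delta> g a \<in> carrier A"
  by (simp add: \<delta>_def)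

lemma \<delta>_submod: "submod B \<Longrightarrow> g \<in> carrier G \<Longrightarrow> b \<in> B \<Longrightarrow> \<delta> g b \<in> B"
  by (simp add: \<delta>_def submodD)

lemma \<delta>_mult:
  "g \<in> carrier G \<Longrightarrow> a \<in> carrier A \<Longrightarrow> b \<in> carrier A \<Longrightarrow> \<delta> g (a \<otimes> b) = \<delta> g a \<otimes> \<delta> g b"
  by (simp add: \<delta>_def act_mult A.inv_mult A.m_ac)

lemma \<delta>_neg: "g \<in> carrier G \<Longrightarrow> a \<in> carrier A \<Longrightarrow> \<delta> g (inv a) = inv (\<delta> g a)"
  by (simp add: \<delta>_def act_neg A.inv_mult)

text \<open>The identity gh - 1 = g(h - 1) + (g - 1) in the group ring.\<close>

lemma \<delta>_cocycle:
  assumes "g \<in> carrier G" "h \<in> carrier G" "a \<in> carrier A"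
  shows "\<delta> (g \<otimes>\<^bsub>G\<^esub> h) a = act g (\<delta> h a) \<otimes> \<delta> g a"
proof -
  have "act g (\<delta> h a) \<otimes> \<delta> g a = act g (act h a) \<otimes> (inv (act g a) \<otimes> act g a) \<otimes> inv a"
    using assms by (simp only: \<delta>_def act_mult act_neg act_closed A.inv_closed A.m_closed A.m_ac)
  then show ?thesis using assms by (simp add: \<delta>_def act_act)
qed

lemma eqv_refl: "subgroup C A \<Longrightarrow> x \<in> carrier A \<Longrightarrow> eqv C x x"
  by (simp add: eqv_def subgroup.one_closed)

lemma eqv_sym:
  assumes "subgroup C A" "eqv C x y"
  shows "eqv C y x"
proof -
  have "inv (x \<otimes> inv y) = y \<otimes> inv x" using assms(2) by (simp add: eqv_def A.inv_mult A.m_comm)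
  then show ?thesis using subgroup.m_inv_closed[OF assms(1), of "x \<otimes> inv y"] assms(2) by (simp add: eqv_def)
qed

lemma eqv_trans:
  assumes "subgroup C A" "eqv C x y" "eqv C y z"
  shows "eqv C x z"
proof -
  have "(x \<otimes> inv y) \<otimes> (y \<otimes> inv z) = x \<otimes> inv z"
    using assms(2,3) by (simp add: eqv_def A.m_assoc) (simp flip: A.m_assoc)
  then show ?thesis using subgroup.m_closed[OF assms(1)] assms(2,3) by (fastforce simp: eqv_def)
qed

lemma eqv_mult:
  assumes "subgroup C A" "eqv C x y" "eqv C z w"
  shows "eqv C (x \<otimes> z) (y \<otimes> w)"
proof -
  have "(x \<otimes> inv y) \<otimes> (z \<otimes> inv w) = (x \<otimes> z) \<otimes> inv (y \<otimes> w)"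
    using assms(2,3) by (simp add: eqv_def A.inv_mult A.m_ac)
  then show ?thesis using subgroup.m_closed[OF assms(1)] assms(2,3) by (fastforce simp: eqv_def)
qed

lemma eqv_mult_right:
  assumes "subgroup C A" "x \<in> carrier A" "c \<in> C"
  shows "eqv C (x \<otimes> c) x"
proof -
  have c: "c \<in> carrier A" using assms subgroup.subset by blast
  have "(x \<otimes> c) \<otimes> inv x = c \<otimes> (x \<otimes> inv x)" using assms(2) c by (simp only: A.m_ac A.inv_closed)
  then show ?thesis using assms c by (simp add: eqv_def)
qed

lemma eqv_cancel:
  assumes "eqv C (x \<otimes> z) (y \<otimes> z)" "x \<in> carrier A" "y \<in> carrier A" "z \<in> carrier A"
  shows "eqv C x y"
proof -
  have "(x \<otimes> z) \<otimes> inv (y \<otimes> z) = x \<otimes> inv y \<otimes> (z \<otimes> inv z)"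
    using assms(2-4) by (simp only: A.inv_mult A.m_ac A.inv_closed A.m_closed)
  then show ?thesis using assms by (simp add: eqv_def)
qed

lemma eqv_act:
  assumes "submod C" "g \<in> carrier G" "eqv C x y"
  shows "eqv C (act g x) (act g y)"
proof -
  have "act g (x \<otimes> inv y) \<in> C" using assms submodD(6)[OF assms(1,2)] by (simp add: eqv_def)
  then show ?thesis using assms by (simp add: eqv_def act_mult act_neg)
qed

lemma eqv_\<delta>: "g \<in> carrier G \<Longrightarrow> a \<in> carrier A \<Longrightarrow> eqv C (act g a) a \<longleftrightarrow> \<delta> g a \<in> C"
  by (simp add: eqv_def \<delta>_def)

section \<open>Cocycles along the lower central series\<close>

lemma lower_central_subset: "lower_central G i \<subseteq> carrier G"
proof (induction i)
  case (Suc i)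
  then have "{h \<otimes>\<^bsub>G\<^esub> g \<otimes>\<^bsub>G\<^esub> inv\<^bsub>G\<^esub> h \<otimes>\<^bsub>G\<^esub> inv\<^bsub>G\<^esub> g | h g. h \<in> lower_central G i \<and> g \<in> carrier G} \<subseteq> carrier G"
    by auto
  then show ?case using G.generate_in_carrier by fastforce
qed simp

text \<open>The correcting factor is the commutator of \<open>z\<close> and \<open>h\<close>. Where
  the next term acts trivially modulo \<open>C\<close>, this makes the actions of \<open>z\<close>
  and \<open>h\<close> on the quotient commute.\<close>

lemma lower_central_commutator:
  assumes "z \<in> lower_central G i" "h \<in> carrier G"
  obtains c where "c \<in> lower_central G (Suc i)" "c \<in> carrier G" "z \<otimes>\<^bsub>G\<^esub> h = c \<otimes>\<^bsub>G\<^esub> (h \<otimes>\<^bsub>G\<^esub> z)"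
proof
  let ?c = "z \<otimes>\<^bsub>G\<^esub> h \<otimes>\<^bsub>G\<^esub> inv\<^bsub>G\<^esub> z \<otimes>\<^bsub>G\<^esub> inv\<^bsub>G\<^esub> h"
  have z: "z \<in> carrier G" using assms lower_central_subset by blast
  show "?c \<in> lower_central G (Suc i)"
    using assms by (auto intro!: generate.incl)
  then show "?c \<in> carrier G" using lower_central_subset by blast
  have "inv\<^bsub>G\<^esub> z \<otimes>\<^bsub>G\<^esub> (inv\<^bsub>G\<^esub> h \<otimes>\<^bsub>G\<^esub> (h \<otimes>\<^bsub>G\<^esub> z)) = \<one>\<^bsub>G\<^esub>"
    using z assms(2) by (simp flip: G.m_assoc)
  then show "z \<otimes>\<^bsub>G\<^esub> h = ?c \<otimes>\<^bsub>G\<^esub> (h \<otimes>\<^bsub>G\<^esub> z)"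
    using z assms(2) by (simp add: G.m_assoc)
qed

lemma cocycle_one:
  assumes "submod B" "cocycle B f"
  shows "f \<one>\<^bsub>G\<^esub> = \<one>"
proof -
  have "f \<one>\<^bsub>G\<^esub> \<in> carrier A" using assms submodD[OF assms(1)] by (auto simp: cocycle_def)
  moreover have "f \<one>\<^bsub>G\<^esub> = f \<one>\<^bsub>G\<^esub> \<otimes> f \<one>\<^bsub>G\<^esub>"
    using assms(2) calculation by (metis act_one cocycle_def G.one_closed G.r_one)
  ultimately show ?thesis by simp
qed

text \<open>Modulo \<open>C\<close>, the value f(zh) is computed in two ways. Writing zh = c(hz)
  with \<open>c\<close> in the next term, where \<open>f\<close> vanishes and the action is trivial,
  gives hf(z) + f(h); expanding zh directly gives f(h) + f(z), since \<open>z\<close> acts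
  trivially. So f(z) is fixed by every \<open>h\<close> modulo \<open>C\<close>, and
  \<open>reduced\<close> applies.\<close>

lemma cocycle_on_lower_central:
  assumes B: "submod B" and C: "submod C" and f: "cocycle B f"
    and reduced: "\<And>b. b \<in> B \<Longrightarrow> (\<And>h. h \<in> carrier G \<Longrightarrow> \<delta> h b \<in> C) \<Longrightarrow> b \<in> C"
    and n: "lower_central G n = {\<one>\<^bsub>G\<^esub>}"
    and triv: "\<And>i z b. j < i \<Longrightarrow> i \<le> n \<Longrightarrow> z \<in> lower_central G i \<Longrightarrow> b \<in> B \<Longrightarrow> \<delta> z b \<in> C"
    and i: "j < i" "i \<le> n"
  shows "\<forall>z\<in>lower_central G i. f z \<in> C"
  using i(2,1)
\<comment> \<open>The induction descends from the trivial term \<open>n\<close> and stays above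
  \<open>j\<close>, since the action is known to be trivial only beyond \<open>j\<close>.\<close>
proof (induction rule: inc_induct)
  case base
  show ?case using n cocycle_one[OF B f] submodD(3)[OF C] by simp
next
  case (step i)
  have i: "j < i" "i \<le> n" using step.hyps step.prems by simp_all
  show ?case
  proof
    fix z
    assume z: "z \<in> lower_central G i"
    have zG: "z \<in> carrier G" using z lower_central_subset by blast
    have fB: "f x \<in> B" if "x \<in> carrier G" for x using f that by (simp add: cocycle_def)
    have fA: "f x \<in> carrier A" if "x \<in> carrier G" for x using fB[OF that] submodD(2)[OF B] by blast
    have f_mult: "f (x \<otimes>\<^bsub>G\<^esub> y) = act x (f y) \<otimes> f x" if "x \<in> carrier G" "y \<in> carrier G" for x y
      using f that by (simp add: cocycle_def)
    note sub = submodD(1)[OF C]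
    show "f z \<in> C"
    proof (rule reduced[OF fB[OF zG]])
      fix h
      assume h: "h \<in> carrier G"
      obtain c where c: "c \<in> lower_central G (Suc i)" "c \<in> carrier G" "z \<otimes>\<^bsub>G\<^esub> h = c \<otimes>\<^bsub>G\<^esub> (h \<otimes>\<^bsub>G\<^esub> z)"
        using lower_central_commutator[OF z h] .
      have hz: "h \<otimes>\<^bsub>G\<^esub> z \<in> carrier G" using h zG by simp
      have "f c \<in> C" using step.IH step.prems c by auto
      have \<delta>c: "\<delta> c (f (h \<otimes>\<^bsub>G\<^esub> z)) \<in> C"
        by (rule triv[OF _ _ c(1) fB[OF hz]]) (use i step.hyps in auto)
      have \<delta>z: "\<delta> z (f h) \<in> C"
        by (rule triv[OF i z fB[OF h]])
      have "eqv C (act c (f (h \<otimes>\<^bsub>G\<^esub> z)) \<otimes> f c) (f (h \<otimes>\<^bsub>G\<^esub> z))"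
      proof (rule eqv_trans[OF sub])
        show "eqv C (act c (f (h \<otimes>\<^bsub>G\<^esub> z)) \<otimes> f c) (act c (f (h \<otimes>\<^bsub>G\<^esub> z)))"
          by (intro eqv_mult_right[OF sub] act_closed c(2) fA hz \<open>f c \<in> C\<close>)
        show "eqv C (act c (f (h \<otimes>\<^bsub>G\<^esub> z))) (f (h \<otimes>\<^bsub>G\<^esub> z))"
          by (simp only: eqv_\<delta>[OF c(2) fA[OF hz]] \<delta>c)
      qed
      then have 1: "eqv C (f (z \<otimes>\<^bsub>G\<^esub> h)) (act h (f z) \<otimes> f h)"
        by (simp only: c(3) f_mult[OF c(2) hz] f_mult[OF h zG])
      have "eqv C (act z (f h) \<otimes> f z) (f h \<otimes> f z)"
        by (intro eqv_mult[OF sub] eqv_refl[OF sub] fA zG) (simp only: eqv_\<delta>[OF zG fA[OF h]] \<delta>z)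
      then have 2: "eqv C (f (z \<otimes>\<^bsub>G\<^esub> h)) (f z \<otimes> f h)"
        by (simp only: f_mult[OF zG h] A.m_comm[OF fA[OF h] fA[OF zG]])
      have "eqv C (act h (f z)) (f z)"
        by (rule eqv_cancel[OF eqv_trans[OF sub eqv_sym[OF sub 1] 2]]) (use fA h zG in auto)
      then show "\<delta> h (f z) \<in> C" by (simp only: eqv_\<delta>[OF h fA[OF zG]])
    qed
  qed
qed

lemma cocycle_diff:
  assumes B: "submod B" and f: "cocycle B f" and b: "b \<in> B"
  shows "cocycle B (\<lambda>x. f x \<otimes> inv (\<delta> x b))"
proof -
  have bA: "b \<in> carrier A" using b submodD(2)[OF B] by blast
  have fB: "f x \<in> B" if "x \<in> carrier G" for x using f that by (simp add: cocycle_def)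
  have fA: "f x \<in> carrier A" if "x \<in> carrier G" for x using fB[OF that] submodD(2)[OF B] by blast
  have "f (x \<otimes>\<^bsub>G\<^esub> y) \<otimes> inv (\<delta> (x \<otimes>\<^bsub>G\<^esub> y) b) =
      act x (f y \<otimes> inv (\<delta> y b)) \<otimes> (f x \<otimes> inv (\<delta> x b))"
    if "x \<in> carrier G" "y \<in> carrier G" for x y
  proof -
    have "f (x \<otimes>\<^bsub>G\<^esub> y) = act x (f y) \<otimes> f x" using f that by (simp add: cocycle_def)
    then show ?thesis
      using that fA bA by (simp add: \<delta>_cocycle act_mult act_neg A.inv_mult A.m_ac)
  qed
  then show ?thesis
    using fB \<delta>_submod[OF B] b submodD[OF B] by (simp add: cocycle_def)
qed

text \<open>If \<open>g\<close> acts on \<open>B/C\<close> without fixed points and \<open>b \<mapsto> gb - b\<close> is onto there, then \<open>f\<close> can be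
  normalised to vanish at \<open>g\<close> modulo \<open>C\<close>; as \<open>g\<close> is central up to elements acting trivially on
  \<open>B/C\<close>, comparing \<open>f(gh)\<close> with \<open>f(hg)\<close> shows that \<open>g\<close> fixes \<open>f(h)\<close> modulo \<open>C\<close>.\<close>

lemma cocycle_inner_mod:
  assumes B: "submod B" and C: "submod C" and f: "cocycle B f"
    and reduced: "\<And>b. b \<in> B \<Longrightarrow> (\<And>h. h \<in> carrier G \<Longrightarrow> \<delta> h b \<in> C) \<Longrightarrow> b \<in> C"
    and n: "lower_central G n = {\<one>\<^bsub>G\<^esub>}"
    and triv: "\<And>i z b. j < i \<Longrightarrow> i \<le> n \<Longrightarrow> z \<in> lower_central G i \<Longrightarrow> b \<in> B \<Longrightarrow> \<delta> z b \<in> C"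
    and j: "j < n" and g: "g \<in> lower_central G j"
    and fixfree: "\<And>b. b \<in> B \<Longrightarrow> \<delta> g b \<in> C \<Longrightarrow> b \<in> C"
    and onto: "\<And>x. x \<in> B \<Longrightarrow> \<exists>b\<in>B. x \<otimes> inv (\<delta> g b) \<in> C"
  shows "\<exists>b\<in>B. cocycle C (\<lambda>x. f x \<otimes> inv (\<delta> x b))"
proof -
  have gG: "g \<in> carrier G" using g lower_central_subset by blast
  then have "f g \<in> B" using f by (simp add: cocycle_def)
  then obtain b where b: "b \<in> B" "f g \<otimes> inv (\<delta> g b) \<in> C" using onto by blast
  define f' where "f' x = f x \<otimes> inv (\<delta> x b)" for x
  have f': "cocycle B f'" using cocycle_diff[OF B f b(1)] by (simp add: f'_def[abs_def])
  have fB: "f' x \<in> B" if "x \<in> carrier G" for x using f' that by (simp add: cocycle_def)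
  have fA: "f' x \<in> carrier A" if "x \<in> carrier G" for x using fB[OF that] submodD(2)[OF B] by blast
  have f_mult: "f' (x \<otimes>\<^bsub>G\<^esub> y) = act x (f' y) \<otimes> f' x" if "x \<in> carrier G" "y \<in> carrier G" for x y
    using f' that by (simp add: cocycle_def)
  have f'g: "f' g \<in> C" using b by (simp add: f'_def)
  note sub = submodD(1)[OF C]
  have "f' h \<in> C" if h: "h \<in> carrier G" for h
  proof (rule fixfree[OF fB[OF h]])
    obtain c where c: "c \<in> lower_central G (Suc j)" "c \<in> carrier G" "g \<otimes>\<^bsub>G\<^esub> h = c \<otimes>\<^bsub>G\<^esub> (h \<otimes>\<^bsub>G\<^esub> g)"
      using lower_central_commutator[OF g h] .
    have hg: "h \<otimes>\<^bsub>G\<^esub> g \<in> carrier G" using h gG by simp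
    have "f' c \<in> C"
    proof -
      have "\<forall>z\<in>lower_central G (Suc j). f' z \<in> C"
        by (rule cocycle_on_lower_central[OF B C f' reduced n]) (use triv j in auto)
      then show ?thesis using c(1) by blast
    qed
    have \<delta>c: "\<delta> c (f' (h \<otimes>\<^bsub>G\<^esub> g)) \<in> C"
      by (rule triv[OF _ _ c(1) fB[OF hg]]) (use j in auto)
    have "eqv C (act c (f' (h \<otimes>\<^bsub>G\<^esub> g)) \<otimes> f' c) (f' (h \<otimes>\<^bsub>G\<^esub> g))"
    proof (rule eqv_trans[OF sub])
      show "eqv C (act c (f' (h \<otimes>\<^bsub>G\<^esub> g)) \<otimes> f' c) (act c (f' (h \<otimes>\<^bsub>G\<^esub> g)))"
        by (intro eqv_mult_right[OF sub] act_closed c(2) fA hg \<open>f' c \<in> C\<close>)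
      show "eqv C (act c (f' (h \<otimes>\<^bsub>G\<^esub> g))) (f' (h \<otimes>\<^bsub>G\<^esub> g))"
        by (simp only: eqv_\<delta>[OF c(2) fA[OF hg]] \<delta>c)
    qed
    \<comment> \<open>The chain to be assembled modulo \<open>C\<close> is gf'(h) = f'(gh) = f'(hg)
      = f'(h); its links are the facts labelled 3, 1 and 2.\<close>
    then have 1: "eqv C (f' (g \<otimes>\<^bsub>G\<^esub> h)) (f' (h \<otimes>\<^bsub>G\<^esub> g))"
      by (simp only: c(3) f_mult[OF c(2) hg])
    have "eqv C (f' h \<otimes> act h (f' g)) (f' h)"
      by (rule eqv_mult_right[OF sub fA[OF h] submodD(6)[OF C h f'g]])
    then have 2: "eqv C (f' (h \<otimes>\<^bsub>G\<^esub> g)) (f' h)"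
      by (simp only: f_mult[OF h gG] A.m_comm[OF fA[OF h] act_closed[OF h fA[OF gG]]])
    have "eqv C (act g (f' h) \<otimes> f' g) (act g (f' h))"
      by (intro eqv_mult_right[OF sub] act_closed gG fA h f'g)
    then have 3: "eqv C (act g (f' h)) (f' (g \<otimes>\<^bsub>G\<^esub> h))"
      by (simp only: f_mult[OF gG h] eqv_sym[OF sub])
    have "eqv C (act g (f' h)) (f' h)"
      by (rule eqv_trans[OF sub 3 eqv_trans[OF sub 1 2]])
    then show "\<delta> g (f' h) \<in> C" by (simp only: eqv_\<delta>[OF gG fA[OF h]])
  qed
  then have "cocycle C f'" using f' by (simp add: cocycle_def)
  then show ?thesis using b(1) by (auto simp: f'_def[abs_def])
qed

end

section \<open>Definable modules\<close>

text \<open>Connectedness of modules is left to \<open>conn\<close>, since the induction runs over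
  submodules; \<open>fixed\<close> is stated once for \<open>A\<close> and inherited by all of
  them.\<close>

locale dim_module = dim_comm_group L M T dim A k + group_module A G act
  for L :: "('f, 'r) lang" and M :: "('u, 'f, 'r) fo_struct" and T dim
    and A :: "'u list monoid" (structure) and k and G :: "'u list monoid" and act +
  fixes m :: nat
  assumes components: "\<And>H. definable_group L M H \<Longrightarrow> has_connected_component L M H"
    and dfbl_G: "dfbl m (carrier G)"
    and dfbl_act: "dfbl (m + (k + k)) {g @ a @ act g a | g a. g \<in> carrier G \<and> a \<in> carrier A}"
    and connected_G: "connected_group L M G"
    and fixed: "fixed_points G A act = {\<one>}"
begin

lemma dfun_act:
  assumes "dfun n h S m t" "\<And>e. e \<in> S \<Longrightarrow> t e \<in> carrier G"
    and "dfun n h S k u" "\<And>e. e \<in> S \<Longrightarrow> u e \<in> carrier A"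
  shows "dfun n h S k (\<lambda>e. act (t e) (u e))"
  using dfbl_act dfbl_G dfbl_carrier _ assms
  by (rule dfun_op) (use carrier_tuples in auto)

lemma G_tuples: "carrier G \<subseteq> tuples m"
  using dfbl_G by (rule dfbl_subset)

lemma dfun_act_const:
  assumes B: "dsubgroup B" and g: "g \<in> carrier G"
  shows "dfun k (\<lambda>x. x) B k (act g)"
proof -
  note B' = dsubgroupD[OF B]
  have "(\<lambda>x. x) \<in> B \<rightarrow> tuples k" using B' by auto
  then show ?thesis
    using g G_tuples B'(3) by (intro dfun_act dfun_const dfun_env) auto
qed

lemma dfun_\<delta>:
  assumes "dfun n h S m t" "\<And>e. e \<in> S \<Longrightarrow> t e \<in> carrier G"
    and "dfun n h S k u" "\<And>e. e \<in> S \<Longrightarrow> u e \<in> carrier A"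
  shows "dfun n h S k (\<lambda>e. \<delta> (t e) (u e))"
  unfolding \<delta>_def using assms by (intro dfun_mult dfun_act dfun_inv) auto

lemma dfun_\<delta>_const:
  assumes B: "dsubgroup B" and g: "g \<in> carrier G"
  shows "dfun k (\<lambda>x. x) B k (\<delta> g)"
proof -
  note B' = dsubgroupD[OF B]
  have "(\<lambda>x. x) \<in> B \<rightarrow> tuples k" using B' by auto
  then show ?thesis
    using g G_tuples B'(3) by (intro dfun_\<delta> dfun_const dfun_env) auto
qed

definition dsubmod :: "'u list set \<Rightarrow> bool" where
  "dsubmod B \<longleftrightarrow> dsubgroup B \<and> submod B"

lemma dsubmodD:
  assumes "dsubmod B"
  shows "dsubgroup B" "submod B" "subgroup B A" "B \<subseteq> carrier A"
  using assms dsubgroupD by (auto simp: dsubmod_def)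

section \<open>Connected components and actions on finite quotients\<close>

text \<open>The least definable subgroup of finite index is connected by transitivity of finite
  index. It is stable under \<open>G\<close> because its preimage under each \<open>g\<close> is
  again a definable subgroup of finite index in \<open>D\<close>, hence contains it.\<close>

lemma connected_component:
  assumes D: "dsubmod D"
  obtains D0 where "dsubmod D0" "conn D0" "D0 \<subseteq> D" "fin_index D D0"
proof -
  note D' = dsubmodD[OF D]
  obtain D0 where D0: "dsubgroup D0" "D0 \<subseteq> D" "fin_index D D0"
    and least: "\<And>K. dsubgroup K \<Longrightarrow> K \<subseteq> D \<Longrightarrow> fin_index D K \<Longrightarrow> D0 \<subseteq> K"
    using components[OF definable_group_subgroup[OF D'(1)]]
    unfolding has_connected_component_def definable_finite_index_iff[OF D'(1)] by blast
  note D0' = dsubgroupD[OF D0(1)]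
  have "conn D0"
    unfolding conn_def
  proof (intro allI impI)
    fix H
    assume H: "dsubgroup H \<and> H \<subseteq> D0 \<and> fin_index D0 H"
    have "fin_index D H"
      by (rule fin_index_trans[where E = D0])
         (use H D0 dsubgroupD(1)[of H] D0'(1) D'(4) submodD(4)[OF D'(2)] in auto)
    then show "H = D0" using least[of H] H D0(2) by auto
  qed
  moreover have "act g x \<in> D0" if g: "g \<in> carrier G" and x: "x \<in> D0" for g x
  proof -
    let ?K = "{x \<in> D. act g x \<in> D0}"
    have actD: "act g y \<in> D" if "y \<in> D" for y using submodD(6)[OF D'(2) g that] .
    have DA: "y \<in> carrier A" if "y \<in> D" for y using D'(4) that by blast
    have K: "dsubgroup ?K"
      by (rule dsubgroup_vimage[OF D'(1) D0(1)])
         (use actD DA g act_mult dfun_act_const[OF D'(1) g] in auto)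
    \<comment> \<open>Each coset of \<open>?K\<close> is the preimage under \<open>g\<close> of a
      coset of \<open>D0\<close>, so there are finitely many.\<close>
    have "D // cong D ?K \<subseteq> (\<lambda>Q. {y \<in> D. act g y \<in> Q}) ` (D // cong D D0)"
    proof
      fix Q
      assume "Q \<in> D // cong D ?K"
      then obtain y where y: "y \<in> D" "Q = cong D ?K `` {y}" by (rule quotientE)
      have "act g (y \<otimes> inv z) = act g y \<otimes> inv (act g z)" if "z \<in> D" for z
        using DA that y(1) g by (simp add: act_mult act_neg)
      moreover have "y \<otimes> inv z \<in> D" if "z \<in> D" for z
        using that y(1) submodD[OF D'(2)] by simp
      ultimately have "Q = {z \<in> D. act g z \<in> cong D D0 `` {act g y}}"
        using y actD by (auto simp: cong_def)
      moreover have "cong D D0 `` {act g y} \<in> D // cong D D0" using actD y by (blast intro: quotientI)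
      ultimately show "Q \<in> (\<lambda>Q. {y \<in> D. act g y \<in> Q}) ` (D // cong D D0)" by (rule image_eqI)
    qed
    then have "fin_index D ?K" by (rule finite_surj[OF D0(3)])
    then have "D0 \<subseteq> ?K" using K by (intro least) auto
    then show ?thesis using x by blast
  qed
  ultimately show ?thesis
    using D0 D0'(1) by (intro that[of D0]) (simp_all add: dsubmod_def submod_def)
qed

text \<open>The stabiliser of a point of the finite set \<open>D/C\<close> has finite index in \<open>G\<close>.\<close>

lemma act_trivial_of_fin_index:
  assumes C: "dsubmod C" and D: "dsubmod D" and CD: "C \<subseteq> D" and fin: "fin_index D C"
    and d: "d \<in> D" and g: "g \<in> carrier G"
  shows "\<delta> g d \<in> C"
proof -
  note C' = dsubmodD[OF C] and D' = dsubmodD[OF D]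
  have dA: "d \<in> carrier A" using d D' by blast
  let ?S = "{g \<in> carrier G. \<delta> g d \<in> C}"
  note CC = dsubgroupD(2)[OF C'(1)]
  have id: "(\<lambda>x. x) \<in> carrier G \<rightarrow> tuples m" using G_tuples by auto
  have "dfbl m ?S"
    using dA id carrier_tuples by (intro dfbl_collect[OF dfbl_G] dpred_in[OF _ CC] dfun_\<delta> dfun_const dfun_env) auto
  then have def: "definable L M ?S" by (rule dfbl_definable)
  have sub: "subgroup ?S G"
  proof (rule G.subgroupI)
    show "?S \<subseteq> carrier G" by auto
    have "\<delta> \<one>\<^bsub>G\<^esub> d = \<one>" using dA by (simp add: \<delta>_def)
    then show "?S \<noteq> {}" using submodD(3)[OF C'(2)] by force
    fix x
    assume x: "x \<in> ?S"
    have "eqv C (act x d) d" using x dA by (simp add: eqv_\<delta>)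
    then have "eqv C (act (inv\<^bsub>G\<^esub> x) (act x d)) (act (inv\<^bsub>G\<^esub> x) d)"
      using x by (intro eqv_act[OF C'(2)]) auto
    moreover have "act (inv\<^bsub>G\<^esub> x) (act x d) = d" using x dA by (simp flip: act_act)
    ultimately have "eqv C (act (inv\<^bsub>G\<^esub> x) d) d" using eqv_sym[OF C'(3)] by simp
    then show "inv\<^bsub>G\<^esub> x \<in> ?S" using x dA by (simp add: eqv_\<delta>)
    fix y
    assume y: "y \<in> ?S"
    have "act x (\<delta> y d) \<in> C" using x y submodD(6)[OF C'(2)] by simp
    then have "act x (\<delta> y d) \<otimes> \<delta> x d \<in> C" using x submodD(4)[OF C'(2)] by simp
    then show "x \<otimes>\<^bsub>G\<^esub> y \<in> ?S" using x y dA by (simp add: \<delta>_cocycle)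
  qed
  \<comment> \<open>With right cosets the orbit map goes through inverses: \<open>y\<close> lies in
    the coset of \<open>x\<close> iff the inverses of \<open>x\<close> and \<open>y\<close> send
    \<open>d\<close> to the same class modulo \<open>C\<close>. So each coset is determined by a
    class in D/C.\<close>
  have "rcosets\<^bsub>G\<^esub> ?S \<subseteq> (\<lambda>Q. {y \<in> carrier G. act (inv\<^bsub>G\<^esub> y) d \<in> Q}) ` (D // cong D C)"
  proof
    fix X
    assume "X \<in> rcosets\<^bsub>G\<^esub> ?S"
    then obtain x where x: "x \<in> carrier G" "X = ?S #>\<^bsub>G\<^esub> x" by (auto simp: RCOSETS_def)
    have inD: "act (inv\<^bsub>G\<^esub> y) d \<in> D" if "y \<in> carrier G" for y
      using that d submodD(6)[OF D'(2)] by simp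
    have "y \<in> X \<longleftrightarrow> act (inv\<^bsub>G\<^esub> y) d \<in> cong D C `` {act (inv\<^bsub>G\<^esub> x) d}" if y: "y \<in> carrier G" for y
    proof -
      have "y \<in> X \<longleftrightarrow> y \<otimes>\<^bsub>G\<^esub> inv\<^bsub>G\<^esub> x \<in> ?S"
        unfolding x(2) by (rule subgroup.rcos_module[OF sub G.is_group x(1) y])
      also have "\<dots> \<longleftrightarrow> eqv C (act y (act (inv\<^bsub>G\<^esub> x) d)) d"
        using x y dA by (simp flip: eqv_\<delta> add: act_act)
      also have "\<dots> \<longleftrightarrow> eqv C (act (inv\<^bsub>G\<^esub> x) d) (act (inv\<^bsub>G\<^esub> y) d)"
      proof
        assume "eqv C (act y (act (inv\<^bsub>G\<^esub> x) d)) d"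
        then have "eqv C (act (inv\<^bsub>G\<^esub> y) (act y (act (inv\<^bsub>G\<^esub> x) d))) (act (inv\<^bsub>G\<^esub> y) d)"
          using y by (intro eqv_act[OF C'(2)]) auto
        moreover have "act (inv\<^bsub>G\<^esub> y) (act y (act (inv\<^bsub>G\<^esub> x) d)) = act (inv\<^bsub>G\<^esub> x) d"
          using x y dA by (simp flip: act_act[of _ y])
        ultimately show "eqv C (act (inv\<^bsub>G\<^esub> x) d) (act (inv\<^bsub>G\<^esub> y) d)" by simp
      next
        assume "eqv C (act (inv\<^bsub>G\<^esub> x) d) (act (inv\<^bsub>G\<^esub> y) d)"
        then have "eqv C (act y (act (inv\<^bsub>G\<^esub> x) d)) (act y (act (inv\<^bsub>G\<^esub> y) d))"
          using y by (intro eqv_act[OF C'(2)]) auto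
        moreover have "act y (act (inv\<^bsub>G\<^esub> y) d) = d"
          using y dA by (simp flip: act_act)
        ultimately show "eqv C (act y (act (inv\<^bsub>G\<^esub> x) d)) d" by simp
      qed
      also have "\<dots> \<longleftrightarrow> act (inv\<^bsub>G\<^esub> y) d \<in> cong D C `` {act (inv\<^bsub>G\<^esub> x) d}"
        using inD x(1) y dA by (simp add: cong_def eqv_def)
      finally show ?thesis .
    qed
    moreover have "X \<subseteq> carrier G"
      using x sub by (simp add: G.r_coset_subset_G subgroup.subset)
    ultimately have "X = {y \<in> carrier G. act (inv\<^bsub>G\<^esub> y) d \<in> cong D C `` {act (inv\<^bsub>G\<^esub> x) d}}"
      by blast
    moreover have "cong D C `` {act (inv\<^bsub>G\<^esub> x) d} \<in> D // cong D C"
      using inD x by (blast intro: quotientI)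
    ultimately show "X \<in> (\<lambda>Q. {y \<in> carrier G. act (inv\<^bsub>G\<^esub> y) d \<in> Q}) ` (D // cong D C)"
      by (rule image_eqI)
  qed
  then have "finite (rcosets\<^bsub>G\<^esub> ?S)" by (rule finite_surj[OF fin])
  with sub def have "definable_finite_index L M G ?S"
    unfolding definable_finite_index_def by (intro conjI)
  with connected_G have "?S = carrier G"
    unfolding connected_group_def by (elim allE impE)
  then show ?thesis using g by blast
qed

text \<open>A proper definable subgroup of a connected group has infinite index, so B/C has positive
  dimension and the tower inequality becomes strict.\<close>

lemma qdim_tower_less:
  assumes C: "dsubgroup C" and B: "dsubgroup B" "conn B" and CB: "C \<subset> B"
  shows "qdim C {\<one>} < qdim B {\<one>}"
proof -
  have "qdim B C + qdim C {\<one>} \<le> qdim B {\<one>}"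
    by (rule qdim_tower[OF dsubgroup_one C B(1)]) (use CB dsubgroupD(5)[OF C] in auto)
  moreover have "qdim B C \<noteq> 0"
    using dim_eq_0[OF interpretable_cong[OF C dsubgroupD(2,3)[OF B(1)]]] B(2) C CB
    by (auto simp: conn_def)
  ultimately show ?thesis by simp
qed

lemma fixed_eq_one:
  assumes "a \<in> carrier A" "\<And>g. g \<in> carrier G \<Longrightarrow> \<delta> g a = \<one>"
  shows "a = \<one>"
proof -
  have "act g a = a" if "g \<in> carrier G" for g
    using assms(2)[OF that] assms(1) that inv_solve_right[of \<one> "act g a" a] by (simp add: \<delta>_def)
  then have "a \<in> fixed_points G A act" using assms(1) by (simp add: fixed_points_def)
  then show ?thesis using fixed by simp
qed

text \<open>Apply the hypothesis to the derivation \<open>h \<mapsto> hb - b\<close>, which takes values in \<open>C\<close>.\<close>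

lemma quotient_fixed_points:
  assumes C: "submod C" and B: "submod B"
    and H1: "\<And>f. cocycle C f \<Longrightarrow> \<exists>c\<in>C. \<forall>x\<in>carrier G. f x = \<delta> x c"
    and b: "b \<in> B" "\<And>h. h \<in> carrier G \<Longrightarrow> \<delta> h b \<in> C"
  shows "b \<in> C"
proof -
  have bA: "b \<in> carrier A" using b submodD(2)[OF B] by blast
  have "cocycle C (\<lambda>h. \<delta> h b)" using b(2) bA by (simp add: cocycle_def \<delta>_cocycle)
  then obtain c where c: "c \<in> C" "\<forall>x\<in>carrier G. \<delta> x b = \<delta> x c" using H1 by blast
  have cA: "c \<in> carrier A" using c submodD(2)[OF C] by blast
  \<comment> \<open>\<open>b\<close> and \<open>c\<close> give the same inner derivation, so their
    difference is fixed by \<open>G\<close>.\<close>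
  have "b \<otimes> inv c = \<one>"
    by (rule fixed_eq_one) (use c cA bA in \<open>simp_all add: \<delta>_mult \<delta>_neg\<close>)
  then have "b = c" using bA cA inv_solve_right[of \<one> b c] by simp
  then show ?thesis using c by simp
qed

text \<open>The induction hypothesis for a smaller \<open>C\<close> is used twice, with different
  derivations: for the fixed points of B/C and for what remains of \<open>f\<close> after
  normalisation. Hence \<open>f\<close> is generalised along with \<open>B\<close>.\<close>

lemma cocycle_inner:
  assumes nil: "lower_central G n = {\<one>\<^bsub>G\<^esub>}"
  shows "dsubmod B \<Longrightarrow> conn B \<Longrightarrow> cocycle B f \<Longrightarrow> \<exists>b\<in>B. \<forall>x\<in>carrier G. f x = \<delta> x b"
proof (induction "qdim B {\<one>}" arbitrary: B f rule: less_induct)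
  case less
  note B = dsubmodD[OF less.prems(1)]
  show ?case
  proof (cases "B = {\<one>}")
    case True
    then show ?thesis using less.prems(3) by (auto simp: cocycle_def \<delta>_def)
  next
    case False
    define P where "P C \<longleftrightarrow> dsubmod C \<and> conn C \<and> C \<subset> B" for C
    have less_B: "qdim C {\<one>} < qdim B {\<one>}" if "P C" for C
      using that dsubmodD(1) qdim_tower_less[OF _ B(1) less.prems(2)] by (auto simp: P_def)
    have "dsubmod {\<one>}"
      using dsubgroup_one dsubgroupD(1)[OF dsubgroup_one] by (auto simp: dsubmod_def submod_def)
    moreover have "conn {\<one>}"
      using dsubgroupD(5) by (auto simp: conn_def)
    ultimately have "P {\<one>}" using False dsubgroupD(5)[OF B(1)] by (auto simp: P_def)
    \<comment> \<open>The zero submodule is a candidate and all candidates have dimension below that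
      of \<open>B\<close>, so a greatest dimension is attained.\<close>
    from ex_has_greatest_nat[of P, OF this, of "\<lambda>C. qdim C {\<one>}"] less_B
    obtain C where "P C" and max: "\<And>D. P D \<Longrightarrow> qdim D {\<one>} \<le> qdim C {\<one>}"
      by blast
    then have C: "dsubmod C" "conn C" "C \<subset> B" by (auto simp: P_def)
    note C' = dsubmodD[OF C(1)]
    have reduced: "b \<in> C" if "b \<in> B" "\<And>h. h \<in> carrier G \<Longrightarrow> \<delta> h b \<in> C" for b
      using C'(2) B(2) less.hyps[OF less_B[OF \<open>P C\<close>] C(1,2)] that by (rule quotient_fixed_points)
    have irreducible: "D = C" if D: "dsubmod D" "C \<subseteq> D" "D \<subset> B" for D
    proof -
      note D' = dsubmodD[OF D(1)]
      obtain D0 where D0: "dsubmod D0" "conn D0" "D0 \<subseteq> D" "fin_index D D0"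
        using connected_component[OF D(1)] .
      note D0' = dsubmodD[OF D0(1)]
      \<comment> \<open>\<open>C\<close> meets \<open>D0\<close> in a definable subgroup of finite
        index in \<open>C\<close>, which is all of \<open>C\<close> by connectedness.\<close>
      have "dsubgroup {x \<in> C. x \<in> D0}"
        using C'(1) D0'(1) C'(4) dsubgroupD(4)[OF C'(1)]
        by (intro dsubgroup_vimage[where \<phi> = "\<lambda>x. x"] dfun_env) auto
      moreover have "fin_index C {x \<in> C. x \<in> D0}"
      proof -
        have "cong C {x \<in> C. x \<in> D0} = cong C D0"
          using submodD(4,5)[OF C'(2)] by (auto simp: cong_def)
        then show ?thesis using fin_index_subset[OF D0(4) D(2)] by simp
      qed
      ultimately have "{x \<in> C. x \<in> D0} = C" using C(2) by (auto simp: conn_def)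
      then have "C \<subseteq> D0" by blast
      \<comment> \<open>A proper inclusion would make \<open>D0\<close> a candidate of larger
        dimension; so \<open>D0 = C\<close>, and D/C is finite.\<close>
      moreover have "\<not> C \<subset> D0"
      proof
        assume "C \<subset> D0"
        then have "qdim C {\<one>} < qdim D0 {\<one>}" using C'(1) D0'(1) D0(2) by (intro qdim_tower_less)
        moreover have "P D0" using D0 D(3) by (auto simp: P_def)
        ultimately show False using max[of D0] by simp
      qed
      ultimately have "fin_index D C" using D0(4) by auto
      then have "\<delta> g d \<in> C" if "d \<in> D" "g \<in> carrier G" for g d
        using act_trivial_of_fin_index[OF C(1) D(1,2)] that by blast
      then show ?thesis using reduced D(2,3) by blast
    qed
    \<comment> \<open>\<open>N i\<close> says that the \<open>i\<close>-th lower central term acts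
      nontrivially on B/C. This holds for term 0, which is \<open>G\<close>, as B/C is nonzero
      without fixed points; the largest such index provides \<open>g\<close>.\<close>
    define N where "N i \<longleftrightarrow> i \<le> n \<and> (\<exists>z\<in>lower_central G i. \<exists>b\<in>B. \<delta> z b \<notin> C)" for i
    have "N 0"
    proof -
      obtain b where "b \<in> B" "b \<notin> C" using C(3) by blast
      then show ?thesis using reduced[of b] by (auto simp: N_def)
    qed
    moreover have "\<forall>i. N i \<longrightarrow> i < Suc n" by (auto simp: N_def)
    ultimately obtain j where "N j" and j_max: "\<And>i. N i \<Longrightarrow> i \<le> j"
      using ex_has_greatest_nat[of N 0 "\<lambda>i. i" "Suc n"] by blast
    then obtain g where g: "g \<in> lower_central G j" "\<exists>b\<in>B. \<delta> g b \<notin> C" and "j \<le> n" by (auto simp: N_def)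
    have gG: "g \<in> carrier G" using g lower_central_subset by blast
    have triv: "\<delta> z b \<in> C" if "j < i" "i \<le> n" "z \<in> lower_central G i" "b \<in> B" for i z b
      using that j_max[of i] by (auto simp: N_def)
    have BA: "b \<in> carrier A" if "b \<in> B" for b using B(4) that by blast
    have "j \<noteq> n"
    proof
      assume "j = n"
      then have "g = \<one>\<^bsub>G\<^esub>" using g(1) nil by simp
      then have "\<delta> g b = \<one>" if "b \<in> B" for b using BA[OF that] by (simp add: \<delta>_def)
      then show False using g(2) submodD(3)[OF C'(2)] by auto
    qed
    with \<open>j \<le> n\<close> have j: "j < n" by simp
    have fixfree: "b \<in> C" if "b \<in> B" "\<delta> g b \<in> C" for b
    proof -
      \<comment> \<open>These are the fixed points of \<open>g\<close> in B/C, lifted to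
        \<open>B\<close>. They form a submodule since \<open>g\<close> commutes with each
        \<open>h\<close> up to \<open>c\<close>, which acts trivially, and a proper one since
        \<open>g\<close> moves something modulo \<open>C\<close>.\<close>
      let ?D = "{b \<in> B. \<delta> g b \<in> C}"
      have "dsubgroup ?D"
        by (rule dsubgroup_vimage[OF B(1) C'(1) _ _ dfun_\<delta>_const[OF B(1) gG]])
           (use BA gG \<delta>_mult in auto)
      moreover have "act h x \<in> ?D" if x: "x \<in> ?D" and h: "h \<in> carrier G" for h x
      proof -
        obtain c where c: "c \<in> lower_central G (Suc j)" "c \<in> carrier G" "g \<otimes>\<^bsub>G\<^esub> h = c \<otimes>\<^bsub>G\<^esub> (h \<otimes>\<^bsub>G\<^esub> g)"
          using lower_central_commutator[OF g(1) h] .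
        have xA: "x \<in> carrier A" using x BA by blast
        have hgx: "act h (act g x) \<in> B" using x h gG submodD(6)[OF B(2)] by simp
        have "act g (act h x) = act c (act h (act g x))"
          using c h gG xA by (metis act_act G.m_closed)
        moreover have "eqv C (act c (act h (act g x))) (act h (act g x))"
          using triv[OF _ _ c(1) hgx] j eqv_\<delta>[OF c(2) BA[OF hgx]] by simp
        moreover have "eqv C (act g x) x"
          using eqv_\<delta>[OF gG xA] x by simp
        ultimately have "eqv C (act g (act h x)) (act h x)"
          using eqv_trans[OF C'(3)] eqv_act[OF C'(2) h] by metis
        then have "\<delta> g (act h x) \<in> C" using eqv_\<delta>[OF gG] xA h by simp
        then show ?thesis using x h submodD(6)[OF B(2)] by simp
      qed
      ultimately have "dsubmod ?D" by (auto simp: dsubmod_def submod_def dsubgroup_def)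
      moreover have "C \<subseteq> ?D" using C(3) \<delta>_submod[OF C'(2) gG] by auto
      moreover have "?D \<subset> B" using g(2) by blast
      ultimately have "?D = C" by (rule irreducible)
      then show ?thesis using that by blast
    qed
    have \<delta>gB: "\<delta> g ` B \<subseteq> B" using \<delta>_submod[OF B(2) gG] by auto
    have hom: "\<delta> g (x \<otimes> y) = \<delta> g x \<otimes> \<delta> g y" if "x \<in> B" "y \<in> B" for x y
      using BA that gG by (simp add: \<delta>_mult)
    have ker: "\<delta> g x \<in> C \<longleftrightarrow> x \<in> C" if "x \<in> B" for x
      using fixfree[OF that] \<delta>_submod[OF C'(2) gG] by blast
    have CB: "C \<subseteq> B" using C(3) by blast
    have image: "{x \<in> B. \<exists>b\<in>B. x \<otimes> inv (\<delta> g b) \<in> C} = B"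
      using fin_index_image_mult[OF B(1) C'(1) CB \<delta>gB hom dfun_\<delta>_const[OF B(1) gG] ker]
        dsubgroup_image_mult[OF B(1) C'(1) \<delta>gB hom dfun_\<delta>_const[OF B(1) gG]]
        less.prems(2) by (auto simp: conn_def)
    have onto: "\<exists>b\<in>B. x \<otimes> inv (\<delta> g b) \<in> C" if "x \<in> B" for x
    proof -
      have "x \<in> {x \<in> B. \<exists>b\<in>B. x \<otimes> inv (\<delta> g b) \<in> C}" unfolding image by (rule that)
      then show ?thesis by simp
    qed
    have "\<exists>b\<in>B. cocycle C (\<lambda>x. f x \<otimes> inv (\<delta> x b))"
      by (rule cocycle_inner_mod[OF B(2) C'(2) less.prems(3) reduced nil triv j g(1) fixfree onto])
    then obtain b where b: "b \<in> B" "cocycle C (\<lambda>x. f x \<otimes> inv (\<delta> x b))" ..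
    obtain c where c: "c \<in> C" "\<forall>x\<in>carrier G. f x \<otimes> inv (\<delta> x b) = \<delta> x c"
      using less.hyps[OF less_B[OF \<open>P C\<close>] C(1,2) b(2)] by blast
    \<comment> \<open>Undoing the normalisation adds \<open>b\<close> to the element found in
      \<open>C\<close>.\<close>
    have "f x = \<delta> x (c \<otimes> b)" if x: "x \<in> carrier G" for x
    proof -
      have "f x \<in> carrier A" using less.prems(3) x BA by (auto simp: cocycle_def)
      moreover have "b \<in> carrier A" "c \<in> carrier A" using b c CB BA by auto
      moreover have "f x \<otimes> inv (\<delta> x b) \<otimes> \<delta> x b = \<delta> x c \<otimes> \<delta> x b" using c x by simp
      ultimately show ?thesis using x by (simp add: \<delta>_mult m_assoc)
    qed
    moreover have "c \<otimes> b \<in> B" using b c CB submodD(4)[OF B(2)] by blast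
    ultimately show ?thesis by blast
  qed
qed

end

section \<open>The first cohomology group\<close>

lemma (in group_module) group_Der: "group (Der G A act)"
proof (rule groupI)
  show "\<exists>h\<in>carrier (Der G A act). h \<otimes>\<^bsub>Der G A act\<^esub> f = \<one>\<^bsub>Der G A act\<^esub>"
    if f: "f \<in> carrier (Der G A act)" for f
  proof
    show "(\<lambda>x\<in>carrier G. inv (f x)) \<in> carrier (Der G A act)"
      using f by (auto simp: Der_def act_neg A.inv_mult PiE_iff)
    show "(\<lambda>x\<in>carrier G. inv (f x)) \<otimes>\<^bsub>Der G A act\<^esub> f = \<one>\<^bsub>Der G A act\<^esub>"
      using f by (auto simp: Der_def PiE_iff intro!: restrict_ext)
  qed
qed (auto simp: Der_def act_mult A.m_ac PiE_iff extensional_def fun_eq_iff restrict_def)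

text \<open>When every derivation is inner, \<open>IDer\<close> is all of \<open>Der\<close>, and a
  group modulo itself is trivial.\<close>

lemma (in group_module) trivial_H1:
  assumes "\<And>f. cocycle (carrier A) f \<Longrightarrow> \<exists>a\<in>carrier A. \<forall>x\<in>carrier G. f x = \<delta> x a"
  shows "trivial_group (H1 G A act)"
proof -
  interpret D: group "Der G A act" by (rule group_Der)
  have "carrier (Der G A act) \<subseteq> IDer G A act"
  proof
    fix f
    assume f: "f \<in> carrier (Der G A act)"
    then have "cocycle (carrier A) f" by (auto simp: Der_def cocycle_def)
    then obtain a where "a \<in> carrier A" "\<forall>x\<in>carrier G. f x = \<delta> x a" using assms by blast
    \<comment> \<open>Members of \<open>Der\<close> and \<open>IDer\<close> are both
      \<open>undefined\<close> outside \<open>carrier G\<close>, so agreement on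
      \<open>carrier G\<close> makes them equal as functions.\<close>
    moreover have "f \<in> extensional (carrier G)" using f by (auto simp: Der_def PiE_iff)
    ultimately show "f \<in> IDer G A act"
      by (auto simp: IDer_def \<delta>_def intro!: exI[of _ a] extensionalityI[of _ "carrier G"])
  qed
  moreover have "IDer G A act \<subseteq> carrier (Der G A act)"
    using \<delta>_cocycle by (auto simp: IDer_def Der_def \<delta>_def)
  ultimately have eq: "IDer G A act = carrier (Der G A act)" by blast
  have "carrier (Der G A act) \<lhd> Der G A act"
    by (rule D.normal_self)
  then interpret N: normal "carrier (Der G A act)" "Der G A act" .
  have "group (H1 G A act)" unfolding H1_def eq by (rule N.factorgroup_is_group)
  moreover have "carrier (H1 G A act) = {\<one>\<^bsub>H1 G A act\<^esub>}"
  proof -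
    have "carrier (Der G A act) #>\<^bsub>Der G A act\<^esub> f = carrier (Der G A act)"
      if "f \<in> carrier (Der G A act)" for f
      using D.coset_join2[OF that D.subgroup_self that] .
    then have "rcosets\<^bsub>Der G A act\<^esub> carrier (Der G A act) = {carrier (Der G A act)}"
      using D.one_closed unfolding RCOSETS_def by blast
    then show ?thesis by (simp add: H1_def eq FactGroup_def)
  qed
  ultimately show ?thesis by (simp add: trivial_group_def)
qed

theorem mainTheorem1:
  fixes L :: "('f, 'r) lang"
    and T :: "('f, 'r) fm set"
    and M :: "('u, 'f, 'r) fo_struct"
    and G A :: "'u list monoid"
    and act :: "'u list \<Rightarrow> 'u list \<Rightarrow> 'u list"
  assumes "is_theory L T"
    and "finite_dimensional_conn TYPE('u) L T"
    and "model L T M"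
    and "definable_module L M G A act"
    and "connected_group L M G"
    and "nilpotent_group G"
    and "connected_group L M A"
    and "fixed_points G A act = {\<one>\<^bsub>A\<^esub>}"
  shows "trivial_group (H1 G A act)"
proof -
  obtain dim :: "('u, 'f, 'r) fo_struct \<Rightarrow> 'u list set set \<Rightarrow> nat" where dim: "is_dimension L T dim"
    using assms(2) by (auto simp: finite_dimensional_conn_def finite_dimensional_def)
  interpret fo_structure L M .
  have mod: "group G" "comm_group A" "act \<in> hom G (AutoGroup A)"
    and G: "definable_group L M G" and A: "definable_group L M A"
    and act: "definable L M {g @ a @ act g a | g a. g \<in> carrier G \<and> a \<in> carrier A}"
    using assms(4) by (auto simp: definable_module_def is_module_def)
  interpret G: group G by fact
  interpret A: comm_group A by fact
  \<comment> \<open>The units witness that the carriers and graphs are nonempty, which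
    \<open>definable_dfbl\<close> uses to fix their arities.\<close>
  have ne: "\<one>\<^bsub>G\<^esub> \<in> carrier G" "\<one>\<^bsub>A\<^esub> \<in> carrier A" by simp_all
  obtain m where m: "carrier G \<subseteq> tuples m"
    using G definable_arity by (auto simp: definable_group_def)
  obtain k where k: "carrier A \<subseteq> tuples k"
    using A definable_arity by (auto simp: definable_group_def)
  interpret group_module A G act
    by unfold_locales (fact mod)
  interpret dim_module L M T dim A k G act m
  proof unfold_locales
    show "dfbl m (carrier G)"
      using G m ne by (auto simp: definable_group_def intro: definable_dfbl)
    show "dfbl k (carrier A)"
      using A k ne by (auto simp: definable_group_def intro: definable_dfbl)
    show "dfbl (k + (k + k)) {x @ y @ (x \<otimes>\<^bsub>A\<^esub> y) | x y. x \<in> carrier A \<and> y \<in> carrier A}"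
    proof (rule definable_dfbl)
      show "{x @ y @ (x \<otimes>\<^bsub>A\<^esub> y) | x y. x \<in> carrier A \<and> y \<in> carrier A} \<subseteq> tuples (k + (k + k))"
        using k A.m_closed by (blast intro: tuples_append)
    qed (use A ne in \<open>auto simp: definable_group_def\<close>)
    show "dfbl (m + (k + k)) {g @ a @ act g a | g a. g \<in> carrier G \<and> a \<in> carrier A}"
    proof (rule definable_dfbl)
      show "{g @ a @ act g a | g a. g \<in> carrier G \<and> a \<in> carrier A} \<subseteq> tuples (m + (k + k))"
        using k m act_closed by (blast intro: tuples_append)
    qed (use act ne in auto)
    show "has_connected_component L M H" if "definable_group L M H" for H
      using assms(2,3) that by (auto simp: finite_dimensional_conn_def)
  qed (fact assms dim)+
  obtain n where n: "lower_central G n = {\<one>\<^bsub>G\<^esub>}"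
    using assms(6) by (auto simp: nilpotent_group_def)
  have "conn (carrier A)"
    using assms(7) definable_finite_index_iff[OF dsubgroup_carrier]
    by (simp add: conn_def connected_group_def)
  moreover have "dsubmod (carrier A)"
    using dsubgroup_carrier dsubgroupD(1)[OF dsubgroup_carrier] by (simp add: dsubmod_def submod_def)
  ultimately show ?thesis
    by (intro trivial_H1 cocycle_inner[OF n])
qed

end
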